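(* Assume that $h^*$ is $\gamma$-strongly convex for some $\gamma>0$. Let $L=\|K\|$, let $\tau_0,\sigma_0>0$ satisfy $\tau_0\sigma_0L^2=1$ and, for $n\ge0$, let $$\theta_{n+1}=1/\sqrt{1+\gamma\sigma_n},\qquad\sigma_{n+1}=\theta_{n+1}\sigma_n,\qquad\tau_{n+1}=\tau_n/\theta_{n+1}.$$ Let $i\in\{1,2,3\}$ and let $(x^n,y^n)_{n\ge0}$ be generated from $(x^0,y^0)\in\mathcal X\times\mathcal Y$, with $x^{-1}=x^0$ (so that the value of $\theta_0$ is irrelevant), by $$y^{n+1}\approx_2^{\delta_{n+1}}\mathrm{prox}_{\sigma_nh^*}\big(y^n+\sigma_nK(x^n+\theta_n(x^n-x^{n-1}))\big),\qquad x^{n+1}\approx_i^{\varepsilon_{n+1}}\mathrm{prox}_{\tau_ng}\big(x^n-\tau_nK^*y^{n+1}\big),\qquad n\ge0,$$ where $\varepsilon_n,\delta_n\ge0$ $(n\ge1)$. For $N\ge1$ put $$T_N:=\sum_{n=1}^N\frac{\tau_{n-1}}{\tau_0},\qquad X^N:=\frac1{T_N}\sum_{n=1}^N\frac{\tau_{n-1}}{\tau_0}x^n,\qquad Y^N:=\frac1{T_N}\sum_{n=1}^N\frac{\tau_{n-1}}{\tau_0}y^n.$$ Let $\alpha>0$ and assume $$\delta_n=O(n^{-2\alpha}),\qquad\varepsilon_n=\begin{cases}O(n^{-(1+2\alpha)})&\text{if }i\in\{1,3\},\\O(n^{-2\alpha})&\text{if }i=2.\end{cases}$$ Then for every saddle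 point $(x^\star,y^\star)$ of $\mathcal L$, as $N\to\infty$, $$\mathcal L(X^N,y^\star)-\mathcal L(x^\star,Y^N)=\begin{cases}O(N^{-2})&\text{if }\alpha>1,\\O(\ln^2(N)/N^2)&\text{if }\alpha=1,\\O(N^{-2\alpha})&\text{if }\alpha\in(0,1).\end{cases}$$
   Context: $\mathcal X,\mathcal Y$ are real Hilbert spaces and $\bar{\mathbb R}=\mathbb R\cup\{+\infty\}$. $K:\mathcal X\to\mathcal Y$ is a bounded linear operator; $g:\mathcal X\to\bar{\mathbb R}$ and $h:\mathcal Y\to\bar{\mathbb R}$ are proper, convex, lower semicontinuous; $h^*$ is the convex conjugate of $h$. Put $$\mathcal L(x,y)=\langle Kx,y\rangle+g(x)-h^*(y).$$ A saddle point is a pair $(x^\star,y^\star)$ with $\mathcal L(x^\star,y)\le\mathcal L(x^\star,y^\star)\le\mathcal L(x,y^\star)$ for all $(x,y)\in\mathcal X\times\mathcal Y$; at least one is assumed to exist. A proper convex lower semicontinuous $\varphi$ is $\gamma$-strongly convex if for every $u\in\mathrm{dom}\,\partial\varphi$, $\varphi(u')\ge\varphi(u)+\langle p,u'-u\rangle+\frac\gamma2\|u'-u\|^2$ for all $p\in\partial\varphi(u)$ and all $u'$. (Strong convexity of $h^*$ corresponds to $h$ having a $1/\gamma$-Lipschitz gradient.) Inexact proximal points. For a proper, convex, lower semicontinuous $\varphi:\mathcal H\to\bar{\mathbb R}$ on a Hilbert space $\mathcal H$, $\lambda>0$ and $v\in\mathcal H$, let $\mathrm{prox}_{\lambda\varphi}(v)=\arg\min_{u}\{\frac1{2\lambda}\|u-v\|^2+\varphi(u)\}$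 and $\Phi_\lambda(u)=\frac1{2\lambda}\|u-v\|^2+\varphi(u)$. For $\varepsilon\ge0$, $\partial_\varepsilon\varphi(z)=\{p:\varphi(u)\ge\varphi(z)+\langle p,u-z\rangle-\varepsilon\ \forall u\}$. Then - $z\approx_1^{\varepsilon}\mathrm{prox}_{\lambda\varphi}(v)$ means $0\in\partial_\varepsilon\Phi_\lambda(z)$; - $z\approx_2^{\varepsilon}\mathrm{prox}_{\lambda\varphi}(v)$ means $(v-z)/\lambda\in\partial_\varepsilon\varphi(z)$; - $z\approx_3^{\varepsilon}\mathrm{prox}_{\lambda\varphi}(v)$ means there is $r\in\mathcal H$ with $\|r\|\le\sqrt{2\lambda\varepsilon}$ and $z=\mathrm{prox}_{\lambda\varphi}(v+r)$. *)

theory Defs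
  imports "HOL-Analysis.Analysis" "HOL-Library.Landau_Symbols"
begin

text \<open>
  Hilbert spaces are types of sort \<open>{real_inner, complete_space}\<close>.  Functions with values in
  the reals extended by plus infinity are \<open>ereal\<close>-valued functions, the value minus infinity
  being excluded by \<open>proper_fun\<close>.
\<close>

definition proper_fun :: "('a \<Rightarrow> ereal) \<Rightarrow> bool" where
  "proper_fun \<phi> \<longleftrightarrow> (\<forall>u. \<phi> u \<noteq> -\<infinity>) \<and> (\<exists>u. \<phi> u \<noteq> \<infinity>)"

definition convex_fun :: "('a::real_vector \<Rightarrow> ereal) \<Rightarrow> bool" where
  "convex_fun \<phi> \<longleftrightarrow>
     (\<forall>u v. \<forall>t\<in>{0<..<1}. \<phi> ((1 - t) *\<^sub>R u + t *\<^sub>R v) \<le> ereal (1 - t) * \<phi> u + ereal t * \<phi> v)"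

definition lsc_fun :: "('a::topological_space \<Rightarrow> ereal) \<Rightarrow> bool" where
  "lsc_fun \<phi> \<longleftrightarrow> (\<forall>u. \<phi> u \<le> Liminf (at u) \<phi>)"

definition convex_conj :: "('a::real_inner \<Rightarrow> ereal) \<Rightarrow> 'a \<Rightarrow> ereal" where
  "convex_conj \<phi> p = (SUP u. ereal (u \<bullet> p) - \<phi> u)"

definition eps_subdiff :: "real \<Rightarrow> ('a::real_inner \<Rightarrow> ereal) \<Rightarrow> 'a \<Rightarrow> 'a set" where
  "eps_subdiff \<epsilon> \<phi> z = {p. \<forall>u. \<phi> z + ereal (p \<bullet> (u - z)) - ereal \<epsilon> \<le> \<phi> u}"

definition subdiff :: "('a::real_inner \<Rightarrow> ereal) \<Rightarrow> 'a \<Rightarrow> 'a set" where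
  "subdiff \<phi> z = {p. \<forall>u. \<phi> z + ereal (p \<bullet> (u - z)) \<le> \<phi> u}"

definition dom_subdiff :: "('a::real_inner \<Rightarrow> ereal) \<Rightarrow> 'a set" where
  "dom_subdiff \<phi> = {u. subdiff \<phi> u \<noteq> {}}"

definition strongly_convex :: "real \<Rightarrow> ('a::real_inner \<Rightarrow> ereal) \<Rightarrow> bool" where
  "strongly_convex \<gamma> \<phi> \<longleftrightarrow>
     (\<forall>u\<in>dom_subdiff \<phi>. \<forall>p\<in>subdiff \<phi> u. \<forall>u'.
        \<phi> u + ereal (p \<bullet> (u' - u)) + ereal (\<gamma> / 2 * (norm (u' - u))\<^sup>2) \<le> \<phi> u')"

definition prox_obj :: "real \<Rightarrow> ('a::real_inner \<Rightarrow> ereal) \<Rightarrow> 'a \<Rightarrow> 'a \<Rightarrow> ereal" where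
  "prox_obj lam \<phi> v u = ereal (1 / (2 * lam) * (norm (u - v))\<^sup>2) + \<phi> u"

text \<open>
  \<open>prox lam \<phi> v\<close> is the set of minimizers, which is a singleton for \<open>lam > 0\<close> and \<open>\<phi>\<close> proper, convex
  and lower semicontinuous on a Hilbert space; \<open>z \<in> prox lam \<phi> v\<close> says that \<open>z\<close> is the proximal point.
\<close>

definition prox :: "real \<Rightarrow> ('a::real_inner \<Rightarrow> ereal) \<Rightarrow> 'a \<Rightarrow> 'a set" where
  "prox lam \<phi> v = {z. is_arg_min (prox_obj lam \<phi> v) (\<lambda>_. True) z}"

definition approx_prox1 :: "real \<Rightarrow> real \<Rightarrow> ('a::real_inner \<Rightarrow> ereal) \<Rightarrow> 'a \<Rightarrow> 'a \<Rightarrow> bool" where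
  "approx_prox1 \<epsilon> lam \<phi> v z \<longleftrightarrow> 0 \<in> eps_subdiff \<epsilon> (prox_obj lam \<phi> v) z"

definition approx_prox2 :: "real \<Rightarrow> real \<Rightarrow> ('a::real_inner \<Rightarrow> ereal) \<Rightarrow> 'a \<Rightarrow> 'a \<Rightarrow> bool" where
  "approx_prox2 \<epsilon> lam \<phi> v z \<longleftrightarrow> (1 / lam) *\<^sub>R (v - z) \<in> eps_subdiff \<epsilon> \<phi> z"

definition approx_prox3 :: "real \<Rightarrow> real \<Rightarrow> ('a::real_inner \<Rightarrow> ereal) \<Rightarrow> 'a \<Rightarrow> 'a \<Rightarrow> bool" where
  "approx_prox3 \<epsilon> lam \<phi> v z \<longleftrightarrow> (\<exists>r. norm r \<le> sqrt (2 * lam * \<epsilon>) \<and> z \<in> prox lam \<phi> (v + r))"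

definition approx_prox ::
  "nat \<Rightarrow> real \<Rightarrow> real \<Rightarrow> ('a::real_inner \<Rightarrow> ereal) \<Rightarrow> 'a \<Rightarrow> 'a \<Rightarrow> bool" where
  "approx_prox i \<epsilon> lam \<phi> v z \<longleftrightarrow>
     i = 1 \<and> approx_prox1 \<epsilon> lam \<phi> v z \<or>
     i = 2 \<and> approx_prox2 \<epsilon> lam \<phi> v z \<or>
     i = 3 \<and> approx_prox3 \<epsilon> lam \<phi> v z"

text \<open>
  If \<open>g x = \<infinity>\<close> and \<open>convex_conj h y = \<infinity>\<close>, then \<open>ereal\<close> arithmetic gives \<open>lagrangian K g h x y = \<infinity>\<close>.
  This does not affect saddle points: for proper \<open>g\<close> and \<open>convex_conj h\<close>, a saddle point always
  has \<open>g x\<close> and \<open>convex_conj h y\<close> finite.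
\<close>

definition lagrangian ::
  "('a::real_inner \<Rightarrow>\<^sub>L 'b::real_inner) \<Rightarrow> ('a \<Rightarrow> ereal) \<Rightarrow> ('b \<Rightarrow> ereal) \<Rightarrow> 'a \<Rightarrow> 'b \<Rightarrow> ereal" where
  "lagrangian K g h x y = ereal (blinfun_apply K x \<bullet> y) + g x - convex_conj h y"

definition saddle_point ::
  "('a::real_inner \<Rightarrow>\<^sub>L 'b::real_inner) \<Rightarrow> ('a \<Rightarrow> ereal) \<Rightarrow> ('b \<Rightarrow> ereal) \<Rightarrow> 'a \<Rightarrow> 'b \<Rightarrow> bool" where
  "saddle_point K g h xs ys \<longleftrightarrow>
     (\<forall>x y. lagrangian K g h xs y \<le> lagrangian K g h xs ys \<and>
            lagrangian K g h xs ys \<le> lagrangian K g h x ys)"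

definition avg_weight :: "(nat \<Rightarrow> real) \<Rightarrow> nat \<Rightarrow> real" where
  "avg_weight \<tau> N = (\<Sum>n=1..N. \<tau> (n - 1) / \<tau> 0)"

definition ergodic_avg :: "(nat \<Rightarrow> real) \<Rightarrow> (nat \<Rightarrow> 'a::real_vector) \<Rightarrow> nat \<Rightarrow> 'a" where
  "ergodic_avg \<tau> x N = (1 / avg_weight \<tau> N) *\<^sub>R (\<Sum>n=1..N. (\<tau> (n - 1) / \<tau> 0) *\<^sub>R x n)"

text \<open>
  Big-O for extended-real sequences.  Finiteness is stated separately because
  \<open>real_of_ereal\<close> maps infinite values to \<open>0\<close>.
\<close>

definition ereal_bigo :: "(nat \<Rightarrow> ereal) \<Rightarrow> (nat \<Rightarrow> real) \<Rightarrow> bool" where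
  "ereal_bigo f r \<longleftrightarrow> (\<forall>N\<ge>1. \<bar>f N\<bar> \<noteq> \<infinity>) \<and> (\<lambda>N. real_of_ereal (f N)) \<in> O(r)"

end

theory Submission
  imports Defs
begin

text \<open>
  With \<open>\<Delta>\<^sub>n\<close> the gap of the iterates \<open>(x n, y n)\<close> and \<open>F\<close> the conjugate of \<open>h\<close>, the primal and
  dual steps combine to \<open>\<tau>\<^sub>n \<Delta>\<^sub>n\<^sub>+\<^sub>1 / 2 + V\<^sub>n\<^sub>+\<^sub>1 \<le> V\<^sub>n + errors\<close> for a Lyapunov function \<open>V\<close> that dominates
  \<open>(norm (x n - xs))\<^sup>2 / 2\<close>.  An \<open>\<epsilon>\<close>-subgradient of a strongly convex \<open>F\<close> retains only half of the
  modulus; the other half comes from the gap itself, which grows quadratically in \<open>y n - ys\<close>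
  because \<open>K xs\<close> is a subgradient of \<open>F\<close> at \<open>ys\<close>.  In all cases the errors sum to
  \<open>O(S\<^sub>N\<^sup>2)\<close> for \<open>S\<^sub>N = \<Sum>n\<le>N. n powr (-\<alpha>)\<close>, and the weights \<open>\<tau>\<^sub>n\<close> grow linearly, so the averaged gap
  is \<open>O(S\<^sub>N\<^sup>2 / N\<^sup>2)\<close>.
\<close>

section \<open>Proximal points and projections\<close>

text \<open>The descent inequality comes from the two subgradient inequalities, tested at
  \<open>xs\<close> and \<open>ys\<close> and multiplied by \<open>\<tau> n\<close>. The squared
  primal distance then keeps weight 1 / 2, while the dual one has weight
  \<open>\<tau> n / \<sigma> n\<close>, which the step sizes raise by
  \<open>\<gamma> * \<tau> n\<close>. Paying for this rise takes the whole strong convexity modulus,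
  so the half lost to inexactness has to be recovered. For positive \<open>n\<close>,
  \<open>\<tau> n * \<theta> n = \<tau> (n - 1)\<close> makes the extrapolated coupling telescope,
  and \<open>\<tau> n * \<sigma> n * (norm K)\<^sup>2 = 1\<close> lets Young's inequality absorb it
  exactly. The obstacle for types 1 and 3 is an error linear in \<open>norm (x n - xs)\<close>, a
  distance not bounded beforehand. Its coefficient is
  \<open>sqrt (2 * \<epsilon> n * \<tau> (n - 1))\<close>, which is of order
  \<open>n powr (- \<alpha>)\<close> thanks to the extra factor 1 / n in the rate of
  \<open>\<epsilon>\<close>; bounding the largest distance up to \<open>N\<close> by the descent
  itself turns the sum of the coefficients into its square. Existence in Hilbert space rests on
  proximal points: projections are proximal points of indicators, and they yield adjoints and affine
  minorants.\<close>

lemma power2_norm_add_scaleR: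
  fixes a b :: "'a::real_inner"
  shows "(norm (a + t *\<^sub>R b))\<^sup>2 = (norm a)\<^sup>2 + 2 * t * (a \<bullet> b) + t\<^sup>2 * (norm b)\<^sup>2"
  unfolding power2_norm_eq_inner
  by (simp add: inner_add inner_commute algebra_simps power2_eq_square)

lemma power2_norm_midpoint:
  fixes a b :: "'a::real_inner"
  shows "(norm ((1 / 2) *\<^sub>R (a + b)))\<^sup>2 = (norm a)\<^sup>2 / 2 + (norm b)\<^sup>2 / 2 - (norm (a - b))\<^sup>2 / 4"
  unfolding power2_norm_eq_inner
  by (simp add: inner_add inner_diff inner_commute field_simps)

lemma convex_fun_ereal:
  assumes "convex_fun \<phi>" "\<phi> u = ereal a" "\<phi> v = ereal b" "0 < t" "t < 1"
  shows "\<phi> ((1 - t) *\<^sub>R u + t *\<^sub>R v) \<le> ereal ((1 - t) * a + t * b)"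
proof -
  have "\<phi> ((1 - t) *\<^sub>R u + t *\<^sub>R v) \<le> ereal (1 - t) * \<phi> u + ereal t * \<phi> v"
    using assms(1,4,5) by (auto simp: convex_fun_def)
  then show ?thesis by (simp add: assms(2,3))
qed

lemma proper_fun_obtain:
  assumes "proper_fun \<phi>"
  obtains u a where "\<phi> u = ereal a"
proof -
  obtain u where "\<phi> u \<noteq> \<infinity>" "\<phi> u \<noteq> -\<infinity>"
    using assms by (auto simp: proper_fun_def)
  then show thesis by (cases "\<phi> u") (auto intro: that)
qed

lemma lsc_fun_eventually_less:
  assumes "lsc_fun \<phi>" "c < \<phi> u"
  shows "eventually (\<lambda>v. c < \<phi> v) (nhds u)"
proof -
  have "c < Liminf (at u) \<phi>"
    using assms unfolding lsc_fun_def by (meson less_le_trans)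
  then have "eventually (\<lambda>v. c < \<phi> v) (at u)"
    by (rule less_LiminfD)
  then show ?thesis
    using assms(2) by (simp add: eventually_nhds_conv_at)
qed

lemma lsc_funI:
  assumes "\<And>u c. c < \<phi> u \<Longrightarrow> eventually (\<lambda>v. c < \<phi> v) (nhds u)"
  shows "lsc_fun \<phi>"
  unfolding lsc_fun_def
proof (intro allI)
  fix u
  show "\<phi> u \<le> Liminf (at u) \<phi>"
    unfolding le_Liminf_iff
    using assms eventually_nhds_conv_at by blast
qed

text \<open>Makes the subgradient inequality at an exact proximal point the case
  \<open>\<epsilon> = 0\<close> of the one for type 1.\<close>

lemma prox_eq_approx_prox1: "prox lam \<phi> v = {z. approx_prox1 0 lam \<phi> v z}"
proof -
  have "z \<in> prox lam \<phi> v \<longleftrightarrow> approx_prox1 0 lam \<phi> v z" for z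
    unfolding prox_def approx_prox1_def eps_subdiff_def is_arg_min_def
    by (auto simp: not_less zero_ereal_def[symmetric])
  then show ?thesis by blast
qed

text \<open>A minimizing sequence is Cauchy by the parallelogram identity.\<close>

lemma prox_exists:
  fixes \<phi> :: "'a::{real_inner, complete_space} \<Rightarrow> ereal"
  assumes \<phi>: "proper_fun \<phi>" "convex_fun \<phi>" "lsc_fun \<phi>"
    and minorant: "\<And>u. ereal (q \<bullet> u + c) \<le> \<phi> u"
    and lam: "lam > 0"
  obtains z where "z \<in> prox lam \<phi> v"
proof -
  define D where "D = {u. \<bar>\<phi> u\<bar> \<noteq> \<infinity>}"
  define J where "J u = 1 / (2 * lam) * (norm (u - v))\<^sup>2 + real_of_ereal (\<phi> u)" for u
  obtain u0 where u0: "u0 \<in> D"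
    using \<phi>(1) unfolding proper_fun_def D_def by (metis (mono_tags) abs_ereal.simps(3) ereal_infinity_cases mem_Collect_eq)
  have D: "\<phi> u = ereal (real_of_ereal (\<phi> u))" if "u \<in> D" for u
    using that by (simp add: D_def ereal_real)
  have J: "prox_obj lam \<phi> v u = ereal (J u)" if "u \<in> D" for u
    unfolding prox_obj_def J_def by (subst D[OF that]) simp
  have notD: "prox_obj lam \<phi> v u = \<infinity>" if "u \<notin> D" for u
  proof -
    have "\<phi> u = \<infinity>"
      using that \<phi>(1) unfolding proper_fun_def D_def by (metis (mono_tags) ereal_infinity_cases mem_Collect_eq)
    then show ?thesis by (simp add: prox_obj_def)
  qed
  \<comment> \<open>Completing the square: the left side is the minimum of the quadratic term plus
    the affine minorant, attained at \<open>v - lam *\<^sub>R q\<close>.\<close>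
  have lower: "q \<bullet> v + c - lam / 2 * (norm q)\<^sup>2 \<le> J u" if "u \<in> D" for u
  proof -
    have "q \<bullet> u + c \<le> real_of_ereal (\<phi> u)"
      using minorant[of u] by (subst (asm) D[OF that]) simp
    moreover have "0 \<le> 1 / (2 * lam) * (norm ((u - v) + lam *\<^sub>R q))\<^sup>2"
      using lam by simp
    moreover have "1 / (2 * lam) * (norm ((u - v) + lam *\<^sub>R q))\<^sup>2
        = 1 / (2 * lam) * (norm (u - v))\<^sup>2 + q \<bullet> (u - v) + lam / 2 * (norm q)\<^sup>2"
      using lam unfolding power2_norm_add_scaleR
      by (simp add: inner_commute[of "u - v" q] field_simps power2_eq_square)
    ultimately show ?thesis by (simp add: J_def inner_diff_right)
  qed
  define m where "m = Inf (J ` D)"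
  have bdd: "bdd_below (J ` D)" using lower by (auto simp: bdd_below_def)
  have m_le: "m \<le> J u" if "u \<in> D" for u
    unfolding m_def using bdd that by (simp add: cInf_lower)
  have "\<exists>u\<in>D. J u < m + 1 / real (Suc n)" for n
  proof -
    have "Inf (J ` D) < m + 1 / real (Suc n)" by (simp add: m_def)
    then show ?thesis using cInf_lessD[of "J ` D"] u0 by blast
  qed
  then obtain z where z: "\<And>n. z n \<in> D" "\<And>n. J (z n) < m + 1 / real (Suc n)"
    by metis
  \<comment> \<open>Both objective values are close to the infimum \<open>m\<close> and the midpoint
    cannot fall below \<open>m\<close>, so the squared distance subtracted at the midpoint must be
    small.\<close>
  have mid: "(norm (z n - z k))\<^sup>2 \<le> 4 * lam * (1 / real (Suc n) + 1 / real (Suc k))" for n k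
  proof -
    let ?w = "(1 - 1 / 2) *\<^sub>R z n + (1 / 2 :: real) *\<^sub>R z k"
    have le: "\<phi> ?w \<le> ereal ((1 - 1 / 2) * real_of_ereal (\<phi> (z n)) + 1 / 2 * real_of_ereal (\<phi> (z k)))"
      by (rule convex_fun_ereal[OF \<phi>(2) D[OF z(1)] D[OF z(1)]]) simp_all
    then have wD: "?w \<in> D"
      using \<phi>(1) unfolding proper_fun_def D_def by auto
    have "real_of_ereal (\<phi> ?w) \<le> real_of_ereal (\<phi> (z n)) / 2 + real_of_ereal (\<phi> (z k)) / 2"
      using le by (subst (asm) D[OF wD]) simp
    moreover
    have "(norm (?w - v))\<^sup>2 = (norm (z n - v))\<^sup>2 / 2 + (norm (z k - v))\<^sup>2 / 2 - (norm (z n - z k))\<^sup>2 / 4"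
    proof -
      have "?w - v = (1 / 2) *\<^sub>R ((z n - v) + (z k - v))"
        by (simp add: algebra_simps flip: scaleR_add_left)
      moreover have "z n - z k = (z n - v) - (z k - v)" by simp
      ultimately show ?thesis
        by (simp only: power2_norm_midpoint)
    qed
    then have "1 / (2 * lam) * (norm (?w - v))\<^sup>2 = (1 / (2 * lam) * (norm (z n - v))\<^sup>2) / 2
        + (1 / (2 * lam) * (norm (z k - v))\<^sup>2) / 2 - 1 / (8 * lam) * (norm (z n - z k))\<^sup>2"
      by (simp only: right_diff_distrib distrib_left) simp
    ultimately have "J ?w \<le> J (z n) / 2 + J (z k) / 2 - 1 / (8 * lam) * (norm (z n - z k))\<^sup>2"
      unfolding J_def add_divide_distrib by linarith
    moreover have half: "d \<le> (r + s) / 2"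
      if "j \<le> a / 2 + b / 2 - d" "m \<le> j" "a < m + r" "b < m + s" for j a b d r s :: real
      using that by simp
    ultimately have "1 / (8 * lam) * (norm (z n - z k))\<^sup>2 \<le> (1 / real (Suc n) + 1 / real (Suc k)) / 2"
      by (intro half[OF _ m_le[OF wD] z(2) z(2)])
    then have "(8 * lam) * (1 / (8 * lam) * (norm (z n - z k))\<^sup>2) \<le> (8 * lam) * ((1 / real (Suc n) + 1 / real (Suc k)) / 2)"
      using lam by (intro mult_left_mono) auto
    then show ?thesis using lam by simp
  qed
  have "Cauchy z"
  proof (rule CauchyI)
    fix e :: real assume e: "e > 0"
    have "(\<lambda>n. 8 * lam * (1 / real (Suc n))) \<longlonglongrightarrow> 8 * lam * 0"
      by (intro tendsto_intros LIMSEQ_Suc[OF lim_1_over_n])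
    then have "eventually (\<lambda>n. 8 * lam * (1 / real (Suc n)) < e\<^sup>2) sequentially"
      using e by (intro order_tendstoD(2)) auto
    then obtain M where M: "\<And>n. n \<ge> M \<Longrightarrow> 8 * lam * (1 / real (Suc n)) < e\<^sup>2"
      unfolding eventually_sequentially by blast
    have "norm (z n - z k) < e" if "n \<ge> M" "k \<ge> M" for n k
    proof -
      have "(norm (z n - z k))\<^sup>2 < e\<^sup>2"
        using mid[of n k] M[OF that(1)] M[OF that(2)] by (simp add: distrib_left)
      then show ?thesis using e by (simp add: power2_less_imp_less)
    qed
    then show "\<exists>M. \<forall>m\<ge>M. \<forall>n\<ge>M. norm (z m - z n) < e" by blast
  qed
  then obtain l where l: "z \<longlonglongrightarrow> l"
    using Cauchy_convergent_iff convergent_def by blast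
  have lim: "(\<lambda>n. m + 1 / real (Suc n) - 1 / (2 * lam) * (norm (z n - v))\<^sup>2)
      \<longlonglongrightarrow> m + 0 - 1 / (2 * lam) * (norm (l - v))\<^sup>2"
    by (intro tendsto_intros l LIMSEQ_Suc[OF lim_1_over_n])
  \<comment> \<open>Any \<open>e < \<phi> l\<close> stays below \<open>\<phi>\<close> along the
    sequence by lower semicontinuity and passes to the limit of the upper bounds. Arguing with such
    \<open>e\<close> does not presuppose that \<open>\<phi> l\<close> is finite, which is a
    consequence.\<close>
  have "\<phi> l \<le> ereal (m - 1 / (2 * lam) * (norm (l - v))\<^sup>2)"
  proof (rule dense_le)
    fix e assume e: "e < \<phi> l"
    then have "eventually (\<lambda>u. e < \<phi> u) (nhds l)" by (rule lsc_fun_eventually_less[OF \<phi>(3)])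
    then have ev: "eventually (\<lambda>n. e < \<phi> (z n)) sequentially"
      using l by (rule eventually_compose_filterlim)
    have upper: "\<phi> (z n) \<le> ereal (m + 1 / real (Suc n) - 1 / (2 * lam) * (norm (z n - v))\<^sup>2)" for n
      using z(2)[of n] unfolding J_def by (subst D[OF z(1)]) simp
    have "eventually (\<lambda>n. e \<le> ereal (m + 1 / real (Suc n) - 1 / (2 * lam) * (norm (z n - v))\<^sup>2)) sequentially"
      using ev by (rule eventually_mono) (rule order_trans[OF less_imp_le upper])
    moreover have "(\<lambda>n. ereal (m + 1 / real (Suc n) - 1 / (2 * lam) * (norm (z n - v))\<^sup>2))
      \<longlonglongrightarrow> ereal (m + 0 - 1 / (2 * lam) * (norm (l - v))\<^sup>2)"
      using lim by (rule tendsto_ereal)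
    ultimately have "e \<le> ereal (m + 0 - 1 / (2 * lam) * (norm (l - v))\<^sup>2)"
      using tendsto_lowerbound trivial_limit_sequentially by blast
    then show "e \<le> ereal (m - 1 / (2 * lam) * (norm (l - v))\<^sup>2)" by simp
  qed
  moreover from this have lD: "l \<in> D"
    using \<phi>(1) unfolding proper_fun_def D_def by auto
  ultimately have "real_of_ereal (\<phi> l) \<le> m - 1 / (2 * lam) * (norm (l - v))\<^sup>2"
    by (subst (asm) D) simp_all
  then have "J l \<le> m" by (simp add: J_def)
  have "prox_obj lam \<phi> v l \<le> prox_obj lam \<phi> v u" for u
    using m_le[of u] \<open>J l \<le> m\<close> J[OF lD] J[of u] notD[of u] by (cases "u \<in> D") auto
  then have "l \<in> prox lam \<phi> v"
    by (auto simp: prox_def is_arg_min_def not_less)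
  then show thesis by (rule that)
qed

text \<open>Compare \<open>z\<close> with the points at fraction \<open>t\<close> of the segment to
  \<open>u\<close> and divide by \<open>t\<close>: convexity leaves the error
  \<open>\<epsilon> / t + t / (2 * lam) * (norm (u - z))\<^sup>2\<close>. The best \<open>t\<close>
  gives the term linear in the distance; the constraint \<open>t \<le> 1\<close> is what costs
  \<open>2 * \<epsilon>\<close>.\<close>

lemma approx_prox1_subgradient:
  fixes \<phi> :: "'a::real_inner \<Rightarrow> ereal"
  assumes \<phi>: "proper_fun \<phi>" "convex_fun \<phi>"
    and lam: "lam > 0" and eps: "\<epsilon> \<ge> 0"
    and z: "approx_prox1 \<epsilon> lam \<phi> v z"
  obtains a where "\<phi> z = ereal a"
    "\<And>u b. \<phi> u = ereal b \<Longrightarrow>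
       a + (1 / lam) *\<^sub>R (v - z) \<bullet> (u - z) - 2 * \<epsilon> - sqrt (2 * \<epsilon> / lam) * norm (u - z) \<le> b"
proof -
  have obj: "prox_obj lam \<phi> v z - ereal \<epsilon> \<le> prox_obj lam \<phi> v u" for u
    using z by (simp add: approx_prox1_def eps_subdiff_def zero_ereal_def[symmetric])
  have "\<phi> z \<noteq> \<infinity>"
  proof
    assume "\<phi> z = \<infinity>"
    moreover obtain u where "\<phi> u \<noteq> \<infinity>" using \<phi>(1) by (auto simp: proper_fun_def)
    ultimately show False using obj[of u] by (simp add: prox_obj_def)
  qed
  moreover have "\<phi> z \<noteq> -\<infinity>" using \<phi>(1) by (simp add: proper_fun_def)
  ultimately obtain a where a: "\<phi> z = ereal a" by (cases "\<phi> z") auto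
  have seg: "a + (1 / lam) *\<^sub>R (v - z) \<bullet> (u - z) - \<epsilon> / t - t / (2 * lam) * (norm (u - z))\<^sup>2 \<le> b"
    if b: "\<phi> u = ereal b" and t: "0 < t" "t \<le> 1" for u b t
  proof -
    define w where "w = (1 - t) *\<^sub>R z + t *\<^sub>R u"
    have "\<phi> w \<le> ereal ((1 - t) * a + t * b)"
    proof (cases "t = 1")
      case True
      then show ?thesis using b by (simp add: w_def)
    next
      case False
      then show ?thesis unfolding w_def using convex_fun_ereal[OF \<phi>(2) a b] t by simp
    qed
    moreover have "\<phi> w \<noteq> -\<infinity>" using \<phi>(1) by (simp add: proper_fun_def)
    ultimately obtain e where e: "\<phi> w = ereal e" "e \<le> (1 - t) * a + t * b"
      by (cases "\<phi> w") auto
    have "1 / (2 * lam) * (norm (z - v))\<^sup>2 + a - \<epsilon> \<le> 1 / (2 * lam) * (norm (w - v))\<^sup>2 + e"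
      using obj[of w] by (simp add: prox_obj_def a e(1))
    moreover have "w - v = (z - v) + t *\<^sub>R (u - z)"
      by (simp add: w_def algebra_simps)
    then have "(norm (w - v))\<^sup>2 = (norm (z - v))\<^sup>2 + 2 * t * ((z - v) \<bullet> (u - z)) + t\<^sup>2 * (norm (u - z))\<^sup>2"
      by (simp only: power2_norm_add_scaleR)
    ultimately have "1 / (2 * lam) * (norm (z - v))\<^sup>2 + a - \<epsilon>
        \<le> 1 / (2 * lam) * ((norm (z - v))\<^sup>2 + 2 * t * ((z - v) \<bullet> (u - z)) + t\<^sup>2 * (norm (u - z))\<^sup>2)
          + ((1 - t) * a + t * b)" using e(2) by simp
    also have "\<dots> = 1 / (2 * lam) * (norm (z - v))\<^sup>2 + t * ((1 / lam) * ((z - v) \<bullet> (u - z)))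
        + t * (t / (2 * lam) * (norm (u - z))\<^sup>2) + ((1 - t) * a + t * b)"
      using lam by (simp add: field_simps power2_eq_square)
    finally have "t * (a - (1 / lam) * ((z - v) \<bullet> (u - z)) - t / (2 * lam) * (norm (u - z))\<^sup>2 - \<epsilon> / t) \<le> t * b"
      using t(1) by (simp add: algebra_simps)
    then have "a - (1 / lam) * ((z - v) \<bullet> (u - z)) - t / (2 * lam) * (norm (u - z))\<^sup>2 - \<epsilon> / t \<le> b"
      using t(1) by simp
    moreover have "(1 / lam) *\<^sub>R (v - z) \<bullet> (u - z) = - ((1 / lam) * ((z - v) \<bullet> (u - z)))"
      by (simp add: inner_diff_left diff_divide_distrib)
    ultimately show ?thesis by simp
  qed
  \<comment> \<open>For \<open>\<epsilon> = 0\<close> the best \<open>t\<close> would be 0, so a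
    positive \<open>e\<close> takes the place of \<open>\<epsilon>\<close> and is sent to
    \<open>\<epsilon>\<close> from the right at the end.\<close>
  have pos: "a + (1 / lam) *\<^sub>R (v - z) \<bullet> (u - z) - 2 * e - sqrt (2 * e / lam) * norm (u - z) \<le> b"
    if b: "\<phi> u = ereal b" and e: "e > 0" "e \<ge> \<epsilon>" for u b e
  proof (cases "sqrt (2 * e * lam) \<le> norm (u - z)")
    case True
    \<comment> \<open>With \<open>d\<close> the distance, \<open>t = r / d\<close> minimizes
      \<open>e / t + t * d\<^sup>2 / (2 * lam)\<close>; both summands are then equal.\<close>
    define r where "r = sqrt (2 * e * lam)"
    have r: "r > 0" "r\<^sup>2 = 2 * e * lam" using e lam by (simp_all add: r_def)
    define d where "d = norm (u - z)"
    have d: "d \<ge> r" "d > 0" using True r unfolding r_def d_def by auto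
    have "\<epsilon> / (r / d) \<le> e / (r / d)" using e r d by (simp add: divide_right_mono)
    moreover have "e / (r / d) + (r / d) / (2 * lam) * d\<^sup>2 = sqrt (2 * e / lam) * d"
    proof -
      have s: "sqrt (2 * e / lam) = r / lam"
        using lam r by (intro real_sqrt_unique) (auto simp: power_divide power2_eq_square)
      have "e = r * r / (2 * lam)" using r lam by (simp add: power2_eq_square)
      then have "e / (r / d) = r * d / (2 * lam)" using r by simp
      moreover have "(r / d) / (2 * lam) * d\<^sup>2 = r * d / (2 * lam)" using d by (simp add: power2_eq_square)
      ultimately show ?thesis unfolding s by simp
    qed
    ultimately show ?thesis
      using seg[OF b, of "r / d"] r d e eps by (simp add: d_def[symmetric])
  next
    case False
    \<comment> \<open>Here the best \<open>t\<close> exceeds 1. At \<open>t = 1\<close> the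
      quadratic error is itself at most \<open>e\<close>.\<close>
    have "(norm (u - z))\<^sup>2 \<le> (sqrt (2 * e * lam))\<^sup>2"
      using False by (intro power_mono) auto
    then have "1 / (2 * lam) * (norm (u - z))\<^sup>2 \<le> 1 / (2 * lam) * (2 * e * lam)"
      using e lam by (intro mult_left_mono) auto
    moreover have "1 / (2 * lam) * (2 * e * lam) = e" using lam by simp
    moreover have "0 \<le> sqrt (2 * e / lam) * norm (u - z)" using e lam by simp
    ultimately show ?thesis using seg[OF b, of 1] e by simp
  qed
  have "a + (1 / lam) *\<^sub>R (v - z) \<bullet> (u - z) - 2 * \<epsilon> - sqrt (2 * \<epsilon> / lam) * norm (u - z) \<le> b"
    if b: "\<phi> u = ereal b" for u b
  proof (rule tendsto_upperbound)
    show "((\<lambda>e. a + (1 / lam) *\<^sub>R (v - z) \<bullet> (u - z) - 2 * e - sqrt (2 * e / lam) * norm (u - z)) \<longlongrightarrow>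
      a + (1 / lam) *\<^sub>R (v - z) \<bullet> (u - z) - 2 * \<epsilon> - sqrt (2 * \<epsilon> / lam) * norm (u - z)) (at_right \<epsilon>)"
      using lam by (intro tendsto_intros) auto
    show "\<forall>\<^sub>F e in at_right \<epsilon>. a + (1 / lam) *\<^sub>R (v - z) \<bullet> (u - z) - 2 * e - sqrt (2 * e / lam) * norm (u - z) \<le> b"
      unfolding eventually_at_right_field using pos[OF b] eps by (intro exI[of _ "\<epsilon> + 1"]) auto
  qed simp
  with a show thesis by (rule that)
qed

lemma prox_subgradient:
  fixes \<phi> :: "'a::real_inner \<Rightarrow> ereal"
  assumes "proper_fun \<phi>" "convex_fun \<phi>" "lam > 0" "z \<in> prox lam \<phi> v"
  obtains a where "\<phi> z = ereal a"
    "\<And>u b. \<phi> u = ereal b \<Longrightarrow> a + (1 / lam) *\<^sub>R (v - z) \<bullet> (u - z) \<le> b"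
proof -
  have "approx_prox1 0 lam \<phi> v z" using assms(4) by (simp add: prox_eq_approx_prox1)
  then show thesis
    by (rule approx_prox1_subgradient[OF assms(1-3) order_refl]) (auto intro: that)
qed

text \<open>The projection is the proximal point, with parameter 1, of the indicator function of
  \<open>S\<close>; its subgradient inequality is the variational inequality.\<close>

lemma closed_convex_projection:
  fixes S :: "'a::{real_inner, complete_space} set"
  assumes "closed S" "convex S" "S \<noteq> {}"
  obtains p where "p \<in> S" "\<And>u. u \<in> S \<Longrightarrow> (a - p) \<bullet> (u - p) \<le> 0"
proof -
  define \<phi> where "\<phi> u = (if u \<in> S then 0 else \<infinity> :: ereal)" for u
  have \<phi>: "proper_fun \<phi>" "convex_fun \<phi>"
    using assms(2,3) by (auto simp: \<phi>_def proper_fun_def convex_fun_def convex_alt)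
  have "lsc_fun \<phi>"
  proof (rule lsc_funI)
    fix u and c :: ereal
    assume c: "c < \<phi> u"
    show "eventually (\<lambda>v. c < \<phi> v) (nhds u)"
    proof (cases "u \<in> S")
      case True
      then have "c < \<phi> v" for v
        using c by (auto simp: \<phi>_def intro: less_trans)
      then show ?thesis by simp
    next
      case False
      then have "eventually (\<lambda>v. v \<in> - S) (nhds u)"
        using assms(1) by (intro eventually_nhds_in_open) auto
      then show ?thesis
        by (rule eventually_mono) (use c False in \<open>simp add: \<phi>_def\<close>)
    qed
  qed
  moreover have "ereal (0 \<bullet> u + 0) \<le> \<phi> u" for u by (simp add: \<phi>_def)
  ultimately obtain p where "p \<in> prox 1 \<phi> a"
    using prox_exists[of \<phi> 0 0 1 a] \<phi> by auto
  then obtain b where b: "\<phi> p = ereal b"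
    and sub: "\<And>u c. \<phi> u = ereal c \<Longrightarrow> b + (1 / 1) *\<^sub>R (a - p) \<bullet> (u - p) \<le> c"
    using prox_subgradient[OF \<phi>, of 1 p a] by (metis zero_less_one)
  have "p \<in> S" "b = 0" using b by (auto simp: \<phi>_def zero_ereal_def split: if_splits)
  have "(a - p) \<bullet> (u - p) \<le> 0" if "u \<in> S" for u
    using sub[of u 0] that \<open>b = 0\<close> by (simp add: \<phi>_def zero_ereal_def)
  with \<open>p \<in> S\<close> show thesis by (rule that)
qed

section \<open>Adjoints and conjugates\<close>

text \<open>The point of the hyperplane \<open>f x = 1\<close> nearest to 0 is orthogonal to the
  kernel of \<open>f\<close>, hence represents \<open>f\<close> up to scaling.\<close>

lemma riesz_representation:
  fixes f :: "'a::{real_inner, complete_space} \<Rightarrow> real"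
  assumes "bounded_linear f"
  obtains r where "\<And>x. f x = x \<bullet> r"
proof (cases "\<forall>x. f x = 0")
  case True
  then show thesis by (intro that[of 0]) simp
next
  case False
  interpret bounded_linear f by fact
  obtain w where w: "f w \<noteq> 0" using False by blast
  define S where "S = {x. f x = 1}"
  have "closed S" unfolding S_def
    by (intro closed_Collect_eq continuous_intros linear_continuous_on assms)
  moreover have "convex S"
    by (auto simp: S_def convex_alt add scale)
  moreover have "(1 / f w) *\<^sub>R w \<in> S" using w by (simp add: S_def scale)
  ultimately obtain p where p: "p \<in> S" "\<And>u. u \<in> S \<Longrightarrow> (0 - p) \<bullet> (u - p) \<le> 0"
    using closed_convex_projection[of S 0] by blast
  have fp: "f p = 1" using p(1) by (simp add: S_def)
  \<comment> \<open>Moving from \<open>p\<close> by \<open>k\<close> and by \<open>- k\<close> stays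
    in the hyperplane, so the variational inequality holds with both signs.\<close>
  have orth: "p \<bullet> k = 0" if "f k = 0" for k
  proof -
    have "p + k \<in> S" "p - k \<in> S" using fp that by (simp_all add: S_def add diff)
    from p(2)[OF this(1)] p(2)[OF this(2)] show ?thesis by simp
  qed
  have "p \<noteq> 0" using fp by auto
  have "f x = x \<bullet> ((1 / (p \<bullet> p)) *\<^sub>R p)" for x
  proof -
    have "p \<bullet> (x - f x *\<^sub>R p) = 0" by (rule orth) (simp add: diff scale fp)
    then have "x \<bullet> p = f x * (p \<bullet> p)" by (simp add: inner_diff_right inner_commute)
    then show ?thesis using \<open>p \<noteq> 0\<close> by simp
  qed
  then show thesis by (rule that)
qed

text \<open>\<open>adjoint\<close> is a choice, so its defining equation holds only once some
  adjoint is known to exist; Riesz representation supplies one pointwise.\<close>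

lemma adjoint_blinfun:
  fixes K :: "'a::{real_inner, complete_space} \<Rightarrow>\<^sub>L 'b::real_inner"
  shows "blinfun_apply K x \<bullet> y = x \<bullet> adjoint (blinfun_apply K) y"
proof -
  have "\<exists>r. \<forall>x. blinfun_apply K x \<bullet> y = x \<bullet> r" for y
    using riesz_representation[of "\<lambda>x. blinfun_apply K x \<bullet> y"]
    by (metis bounded_linear_inner_left_comp blinfun.bounded_linear_right)
  then have "\<exists>f. \<forall>x y. blinfun_apply K x \<bullet> y = x \<bullet> f y" by metis
  then have "\<forall>x y. blinfun_apply K x \<bullet> y = x \<bullet> adjoint (blinfun_apply K) y"
    unfolding adjoint_def by (rule someI_ex)
  then show ?thesis by blast
qed

text \<open>Separate a point strictly below the graph from the epigraph by projecting it.\<close>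

lemma affine_minorant_exists:
  fixes h :: "'a::{real_inner, complete_space} \<Rightarrow> ereal"
  assumes h: "proper_fun h" "convex_fun h" "lsc_fun h"
  obtains p c where "\<And>u. ereal (u \<bullet> p + c) \<le> h u"
proof -
  define S where "S = {(u, r). h u \<le> ereal r}"
  obtain u0 a where a: "h u0 = ereal a"
    using proper_fun_obtain[OF h(1)] .
  have nm: "h u \<noteq> -\<infinity>" for u using h(1) by (simp add: proper_fun_def)
  have "convex S"
    unfolding convex_alt
  proof clarify
    fix u r v s and t :: real
    assume uv: "(u, r) \<in> S" "(v, s) \<in> S" and t: "0 \<le> t" "t \<le> 1"
    obtain b c where bc: "h u = ereal b" "h v = ereal c" "b \<le> r" "c \<le> s"
      using uv nm[of u] nm[of v] unfolding S_def by (cases "h u"; cases "h v") auto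
    have "h ((1 - t) *\<^sub>R u + t *\<^sub>R v) \<le> ereal ((1 - t) * b + t * c)"
    proof (cases "t = 0 \<or> t = 1")
      case True
      then show ?thesis using bc by auto
    next
      case False
      then show ?thesis using convex_fun_ereal[OF h(2) bc(1,2)] t by auto
    qed
    also have "\<dots> \<le> ereal ((1 - t) * r + t * s)"
      using bc t by (auto intro!: add_mono mult_left_mono)
    finally show "(1 - t) *\<^sub>R (u, r) + t *\<^sub>R (v, s) \<in> S" by (simp add: S_def)
  qed
  moreover have "closed S"
    unfolding closed_def open_prod_def
  proof
    fix ur assume ur: "ur \<in> - S"
    obtain u r where [simp]: "ur = (u, r)" by (cases ur)
    have "ereal r < h u" using ur by (simp add: S_def not_le)
    then obtain s where s: "ereal r < ereal s" "ereal s < h u"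
      by (metis ereal_dense2 ereal_less_ereal_Ex less_ereal.simps(1) order.strict_trans)
    obtain A where "open A" "u \<in> A" "\<And>v. v \<in> A \<Longrightarrow> ereal s < h v"
      using lsc_fun_eventually_less[OF h(3) s(2)] unfolding eventually_nhds by blast
    then show "\<exists>A B. open A \<and> open B \<and> ur \<in> A \<times> B \<and> A \<times> B \<subseteq> - S"
      using s(1) by (intro exI[of _ A] exI[of _ "{..<s}"])
        (auto simp: S_def not_le, meson dual_order.strict_trans2 ereal_less_eq(3) less_le_not_le linorder_not_le order_less_imp_le order_trans)
  qed
  moreover have a_in: "(u0, a) \<in> S" by (simp add: S_def a)
  ultimately obtain wr where wr: "wr \<in> S"
    "\<And>us. us \<in> S \<Longrightarrow> ((u0, a - 1) - wr) \<bullet> (us - wr) \<le> 0"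
    using closed_convex_projection[of S "(u0, a - 1)"] by blast
  obtain w r where [simp]: "wr = (w, r)" by (cases wr)
  have sep: "(u0 - w) \<bullet> (u - w) + (a - 1 - r) * (s - r) \<le> 0" if "h u \<le> ereal s" for u s
    using wr(2)[of "(u, s)"] that by (simp add: S_def)
  define \<beta> where "\<beta> = r - (a - 1)"
  \<comment> \<open>Testing with \<open>(u0, a)\<close>, the graph point directly above the
    projected one, shows that the separating hyperplane is not vertical: \<open>\<beta>\<close>
    cannot be negative, and \<open>\<beta> = 0\<close> would put \<open>(u0, a - 1)\<close> into the
    epigraph.\<close>
  have main: "(norm (u0 - w))\<^sup>2 \<le> \<beta> * (1 - \<beta>)"
    using sep[of u0 a] a by (simp add: \<beta>_def power2_norm_eq_inner algebra_simps)
  have "\<beta> \<ge> 0"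
  proof (rule ccontr)
    assume "\<not> \<beta> \<ge> 0"
    then have "\<beta> * (1 - \<beta>) < 0" by (simp add: mult_neg_pos)
    then show False using main by (smt (verit) zero_le_power2)
  qed
  moreover have "\<beta> \<noteq> 0"
  proof
    assume 0: "\<beta> = 0"
    then have "u0 = w" "r = a - 1" using main by (auto simp: \<beta>_def)
    then show False using wr(1) a by (simp add: S_def)
  qed
  ultimately have \<beta>: "\<beta> > 0" by simp
  have "ereal (u \<bullet> ((1 / \<beta>) *\<^sub>R (u0 - w)) + (r - (u0 - w) \<bullet> w / \<beta>)) \<le> h u" for u
  proof (cases "h u")
    case (real s)
    have "(u0 - w) \<bullet> (u - w) \<le> \<beta> * (s - r)"
      using sep[of u s] real by (simp add: \<beta>_def algebra_simps)
    then have "(u0 - w) \<bullet> (u - w) / \<beta> \<le> s - r" using \<beta> by (simp add: field_simps)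
    moreover have "(u0 - w) \<bullet> (u - w) = u \<bullet> (u0 - w) - (u0 - w) \<bullet> w"
      by (simp add: inner_diff inner_commute)
    ultimately have "u \<bullet> (u0 - w) / \<beta> - (u0 - w) \<bullet> w / \<beta> \<le> s - r"
      by (simp add: diff_divide_distrib)
    then show ?thesis using real by simp
  qed (use nm[of u] in auto)
  then show thesis by (rule that)
qed

lemma convex_conj_ge: "h u = ereal a \<Longrightarrow> ereal (u \<bullet> p - a) \<le> convex_conj h p"
  unfolding convex_conj_def by (rule SUP_upper2[of u]) auto

text \<open>A finite value of \<open>h\<close> excludes minus infinity, and the slope of an affine
  minorant of \<open>h\<close> is a point where the conjugate is finite.\<close>

lemma convex_conj_proper:
  fixes h :: "'a::{real_inner, complete_space} \<Rightarrow> ereal"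
  assumes h: "proper_fun h" "convex_fun h" "lsc_fun h"
  shows "proper_fun (convex_conj h)"
proof -
  obtain u0 a where a: "h u0 = ereal a"
    using proper_fun_obtain[OF h(1)] .
  have "convex_conj h p \<noteq> -\<infinity>" for p
    using convex_conj_ge[of h, OF a, of p] by auto
  moreover obtain p c where pc: "\<And>u. ereal (u \<bullet> p + c) \<le> h u"
    using affine_minorant_exists[OF h] by blast
  have "convex_conj h p \<le> ereal (- c)"
    unfolding convex_conj_def
  proof (rule SUP_least)
    fix u
    show "ereal (u \<bullet> p) - h u \<le> ereal (- c)"
      using pc[of u] by (cases "h u") auto
  qed
  then have "convex_conj h p \<noteq> \<infinity>" by auto
  ultimately show ?thesis unfolding proper_fun_def by blast
qed

lemma convex_conj_convex:
  fixes h :: "'a::real_inner \<Rightarrow> ereal"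
  assumes h: "proper_fun h"
  shows "convex_fun (convex_conj h)"
  unfolding convex_fun_def
proof (intro allI ballI)
  fix p q and t :: real
  assume t: "t \<in> {0<..<1}"
  show "convex_conj h ((1 - t) *\<^sub>R p + t *\<^sub>R q)
    \<le> ereal (1 - t) * convex_conj h p + ereal t * convex_conj h q"
    unfolding convex_conj_def[of _ "(1 - t) *\<^sub>R p + t *\<^sub>R q"]
  proof (rule SUP_least)
    fix u
    show "ereal (u \<bullet> ((1 - t) *\<^sub>R p + t *\<^sub>R q)) - h u
      \<le> ereal (1 - t) * convex_conj h p + ereal t * convex_conj h q"
    proof (cases "h u")
      case (real a)
      have "ereal (1 - t) * ereal (u \<bullet> p - a) + ereal t * ereal (u \<bullet> q - a)
        \<le> ereal (1 - t) * convex_conj h p + ereal t * convex_conj h q"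
        using t convex_conj_ge[of h, OF real] by (intro add_mono ereal_mult_left_mono) auto
      then show ?thesis using real by (simp add: inner_add_right algebra_simps)
    qed (use h in \<open>auto simp: proper_fun_def\<close>)
  qed
qed

text \<open>The conjugate is a supremum of continuous affine functions, so a strict lower bound is
  already attained by one of them and persists nearby.\<close>

lemma convex_conj_lsc:
  fixes h :: "'a::real_inner \<Rightarrow> ereal"
  assumes h: "proper_fun h"
  shows "lsc_fun (convex_conj h)"
proof (rule lsc_funI)
  fix p and c :: ereal
  assume "c < convex_conj h p"
  then obtain u where u: "c < ereal (u \<bullet> p) - h u"
    unfolding convex_conj_def less_SUP_iff by blast
  then obtain a where a: "h u = ereal a"
    using h by (cases "h u") (auto simp: proper_fun_def)
  have "((\<lambda>q. ereal (u \<bullet> q - a)) \<longlongrightarrow> ereal (u \<bullet> p - a)) (nhds p)"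
    by (intro tendsto_ereal tendsto_intros filterlim_ident)
  then have "eventually (\<lambda>q. c < ereal (u \<bullet> q - a)) (nhds p)"
    using u a by (intro order_tendstoD) auto
  then show "eventually (\<lambda>q. c < convex_conj h q) (nhds p)"
    by (rule eventually_mono) (use convex_conj_ge[of h, OF a] in \<open>auto intro: less_le_trans\<close>)
qed

section \<open>Inexact subgradients\<close>

lemma eps_subdiff_finite:
  assumes \<phi>: "proper_fun \<phi>" and p: "p \<in> eps_subdiff \<epsilon> \<phi> z"
  obtains a where "\<phi> z = ereal a" "\<And>u b. \<phi> u = ereal b \<Longrightarrow> a + p \<bullet> (u - z) - \<epsilon> \<le> b"
proof -
  have sub: "\<phi> z + ereal (p \<bullet> (u - z)) - ereal \<epsilon> \<le> \<phi> u" for u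
    using p by (simp add: eps_subdiff_def)
  obtain u b where u: "\<phi> u = ereal b" using proper_fun_obtain[OF \<phi>] .
  have "\<phi> z \<noteq> \<infinity>" using sub[of u] u by auto
  moreover have "\<phi> z \<noteq> -\<infinity>" using \<phi> by (simp add: proper_fun_def)
  ultimately obtain a where a: "\<phi> z = ereal a" by (cases "\<phi> z") auto
  have "a + p \<bullet> (u - z) - \<epsilon> \<le> b" if "\<phi> u = ereal b" for u b
    using sub[of u] that a by simp
  with a show thesis by (rule that)
qed

text \<open>A common form of the three notions, so that the descent estimate is run only once. The
  linear error comes from the segment argument for type 1 and from Cauchy-Schwarz applied to the
  shift \<open>r\<close> for type 3; type 2 has none, which is why it tolerates a slower decay of
  \<open>\<epsilon>\<close>.\<close>

lemma approx_prox_subgradient: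
  fixes \<phi> :: "'a::real_inner \<Rightarrow> ereal"
  assumes \<phi>: "proper_fun \<phi>" "convex_fun \<phi>"
    and lam: "lam > 0" and eps: "\<epsilon> \<ge> 0"
    and z: "approx_prox i \<epsilon> lam \<phi> v z"
  obtains a where "\<phi> z = ereal a"
    "\<And>u b. \<phi> u = ereal b \<Longrightarrow>
       a + (1 / lam) *\<^sub>R (v - z) \<bullet> (u - z) - 2 * \<epsilon>
         - (if i = 2 then 0 else sqrt (2 * \<epsilon> / lam)) * norm (u - z) \<le> b"
proof -
  consider "i = 1" "approx_prox1 \<epsilon> lam \<phi> v z" | "i = 2" "approx_prox2 \<epsilon> lam \<phi> v z"
    | "i = 3" "approx_prox3 \<epsilon> lam \<phi> v z"
    using z by (auto simp: approx_prox_def)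
  then show thesis
  proof cases
    case 1
    obtain a where a: "\<phi> z = ereal a"
      "\<And>u b. \<phi> u = ereal b \<Longrightarrow>
       a + (1 / lam) *\<^sub>R (v - z) \<bullet> (u - z) - 2 * \<epsilon> - sqrt (2 * \<epsilon> / lam) * norm (u - z) \<le> b"
      by (rule approx_prox1_subgradient[OF \<phi> lam eps 1(2)]) blast
    show thesis by (rule that[OF a(1)]) (use a(2) 1(1) in simp)
  next
    case 2
    obtain a where a: "\<phi> z = ereal a"
      "\<And>u b. \<phi> u = ereal b \<Longrightarrow> a + (1 / lam) *\<^sub>R (v - z) \<bullet> (u - z) - \<epsilon> \<le> b"
      using 2(2) unfolding approx_prox2_def by (rule eps_subdiff_finite[OF \<phi>(1)]) blast
    show thesis
    proof (rule that[OF a(1)])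
      fix u b assume "\<phi> u = ereal b"
      from a(2)[OF this] show "a + (1 / lam) *\<^sub>R (v - z) \<bullet> (u - z) - 2 * \<epsilon>
         - (if i = 2 then 0 else sqrt (2 * \<epsilon> / lam)) * norm (u - z) \<le> b"
        using 2(1) eps by simp
    qed
  next
    case 3
    then obtain r where r: "norm r \<le> sqrt (2 * lam * \<epsilon>)" "z \<in> prox lam \<phi> (v + r)"
      by (auto simp: approx_prox3_def)
    obtain a where a: "\<phi> z = ereal a"
      "\<And>u b. \<phi> u = ereal b \<Longrightarrow> a + (1 / lam) *\<^sub>R (v + r - z) \<bullet> (u - z) \<le> b"
      by (rule prox_subgradient[OF \<phi> lam r(2)]) blast
    have s: "sqrt (2 * lam * \<epsilon>) / lam = sqrt (2 * \<epsilon> / lam)"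
      using lam eps by (intro real_sqrt_unique[symmetric]) (auto simp: power_divide power2_eq_square)
    show thesis
    proof (rule that[OF a(1)])
      fix u b assume "\<phi> u = ereal b"
      note a(2)[OF this]
      moreover have "(1 / lam) *\<^sub>R (v + r - z) \<bullet> (u - z) = (1 / lam) *\<^sub>R (v - z) \<bullet> (u - z) + (1 / lam) * (r \<bullet> (u - z))"
        by (simp add: inner_diff_left inner_add_left diff_divide_distrib add_divide_distrib)
      moreover have "(1 / lam) * (- (r \<bullet> (u - z))) \<le> (1 / lam) * (sqrt (2 * lam * \<epsilon>) * norm (u - z))"
      proof (rule mult_left_mono)
        have "- (r \<bullet> (u - z)) \<le> norm r * norm (u - z)"
          using Cauchy_Schwarz_ineq2[of r "u - z"] by linarith
        also have "\<dots> \<le> sqrt (2 * lam * \<epsilon>) * norm (u - z)"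
          using r(1) by (intro mult_right_mono) auto
        finally show "- (r \<bullet> (u - z)) \<le> sqrt (2 * lam * \<epsilon>) * norm (u - z)" .
      qed (use lam in simp)
      then have "- ((1 / lam) * (r \<bullet> (u - z))) \<le> sqrt (2 * \<epsilon> / lam) * norm (u - z)"
        by (simp flip: s)
      ultimately show "a + (1 / lam) *\<^sub>R (v - z) \<bullet> (u - z) - 2 * \<epsilon>
         - (if i = 2 then 0 else sqrt (2 * \<epsilon> / lam)) * norm (u - z) \<le> b"
        using 3(1) eps by simp
    qed
  qed
qed

text \<open>
  Strong convexity constrains exact subgradients only; the exact subgradient at the proximal
  point of \<open>z + p / \<gamma>\<close> is close to the \<open>\<epsilon>\<close>-subgradient \<open>p\<close> (Brondsted--Rockafellar).
\<close>

lemma strongly_convex_eps_subgradient: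
  fixes \<phi> :: "'a::{real_inner, complete_space} \<Rightarrow> ereal"
  assumes \<phi>: "proper_fun \<phi>" "convex_fun \<phi>" "lsc_fun \<phi>"
    and minorant: "\<And>u. ereal (q \<bullet> u + c) \<le> \<phi> u"
    and \<gamma>: "\<gamma> > 0" and strong: "strongly_convex \<gamma> \<phi>"
    and p: "p \<in> eps_subdiff \<epsilon> \<phi> z"
    and z: "\<phi> z = ereal a" and u: "\<phi> u = ereal b"
  shows "a + p \<bullet> (u - z) + \<gamma> / 4 * (norm (u - z))\<^sup>2 - 7 / 2 * \<epsilon> \<le> b"
proof -
  obtain z' where z': "z' \<in> prox (1 / \<gamma>) \<phi> (z + (1 / \<gamma>) *\<^sub>R p)"
    by (rule prox_exists[OF \<phi> minorant, of "1 / \<gamma>" "z + (1 / \<gamma>) *\<^sub>R p"]) (use \<gamma> in auto)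
  define d where "d = z - z'"
  define w where "w = u - z'"
  have uz: "u - z = w - d" by (simp add: d_def w_def)
  obtain a' where a': "\<phi> z' = ereal a'" and
    sub: "\<And>u b. \<phi> u = ereal b \<Longrightarrow> a' + (1 / (1 / \<gamma>)) *\<^sub>R (z + (1 / \<gamma>) *\<^sub>R p - z') \<bullet> (u - z') \<le> b"
    by (rule prox_subgradient[OF \<phi>(1,2) _ z']) (use \<gamma> in auto)
  have p': "(1 / (1 / \<gamma>)) *\<^sub>R (z + (1 / \<gamma>) *\<^sub>R p - z') = p + \<gamma> *\<^sub>R d"
    using \<gamma> by (simp add: d_def algebra_simps)
  have "p + \<gamma> *\<^sub>R d \<in> subdiff \<phi> z'"
    unfolding subdiff_def mem_Collect_eq
  proof
    fix v
    show "\<phi> z' + ereal ((p + \<gamma> *\<^sub>R d) \<bullet> (v - z')) \<le> \<phi> v"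
      using sub[of v] \<phi>(1) unfolding p' a' proper_fun_def by (cases "\<phi> v") auto
  qed
  then have "\<phi> z' + ereal ((p + \<gamma> *\<^sub>R d) \<bullet> (u - z')) + ereal (\<gamma> / 2 * (norm (u - z'))\<^sup>2) \<le> \<phi> u"
    using strong unfolding strongly_convex_def dom_subdiff_def by blast
  then have 3: "a' + (p \<bullet> w + \<gamma> * (d \<bullet> w)) + \<gamma> / 2 * (norm w)\<^sup>2 \<le> b"
    by (simp add: a' u w_def inner_add_left)
  have 2: "a - p \<bullet> d - \<epsilon> \<le> a'"
  proof (rule eps_subdiff_finite[OF \<phi>(1) p])
    fix a2 assume "\<phi> z = ereal a2" "\<And>u b. \<phi> u = ereal b \<Longrightarrow> a2 + p \<bullet> (u - z) - \<epsilon> \<le> b"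
    from this(1) this(2)[OF a'] show ?thesis using z by (simp add: d_def inner_diff_right)
  qed
  have "a' + (p \<bullet> d + \<gamma> * (norm d)\<^sup>2) \<le> a"
    using sub[OF z] unfolding p' d_def[symmetric] by (simp add: inner_add_left power2_norm_eq_inner)
  \<comment> \<open>The two inequalities compare \<open>\<phi> z\<close> and
    \<open>\<phi> z'\<close> in opposite directions, and their linear terms in \<open>p\<close>
    cancel.\<close>
  with 2 have d: "\<gamma> * (norm d)\<^sup>2 \<le> \<epsilon>" by simp
  have sq: "(norm (w - d))\<^sup>2 = (norm w)\<^sup>2 - 2 * (d \<bullet> w) + (norm d)\<^sup>2"
    using power2_norm_add_scaleR[of w "-1" d] by (simp add: inner_commute)
  \<comment> \<open>The factor 3 completes the square that the cross terms
    \<open>d \<bullet> w\<close> require. It leaves 9 / 4 + 1 / 4 = 5 / 2 times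
    \<open>\<gamma> * (norm d)\<^sup>2\<close>, which is at most \<open>\<epsilon>\<close>; with the
    \<open>\<epsilon>\<close> of inequality 2 this makes 7 / 2.\<close>
  have "0 \<le> \<gamma> / 4 * (norm (w + 3 *\<^sub>R d))\<^sup>2" using \<gamma> by simp
  also have "\<dots> = \<gamma> / 4 * (norm w)\<^sup>2 + 3 / 2 * (\<gamma> * (d \<bullet> w)) + 9 / 4 * (\<gamma> * (norm d)\<^sup>2)"
    unfolding power2_norm_add_scaleR by (simp add: inner_commute algebra_simps)
  finally have "\<gamma> / 4 * ((norm w)\<^sup>2 - 2 * (d \<bullet> w) + (norm d)\<^sup>2) - 5 / 2 * \<epsilon>
      \<le> \<gamma> * (d \<bullet> w) + \<gamma> / 2 * (norm w)\<^sup>2"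
    using d by (simp add: algebra_simps)
  with 2 3 show ?thesis unfolding uz sq by (simp add: inner_diff_right)
qed

section \<open>Sequences of reals\<close>

text \<open>The finitely many indices before the asymptotic bound sets in are absorbed by adding the
  sum \<open>s\<close> of their ratios to the constant.\<close>

lemma bigo_powr_bound:
  fixes f :: "nat \<Rightarrow> real"
  assumes "f \<in> O(\<lambda>n. real n powr p)"
  obtains C where "C \<ge> 0" "\<And>n. n \<ge> 1 \<Longrightarrow> \<bar>f n\<bar> \<le> C * real n powr p"
proof -
  obtain c where c: "c > 0" "eventually (\<lambda>n. norm (f n) \<le> c * norm (real n powr p)) sequentially"
    using assms by (elim landau_o.bigE)
  then obtain M where M: "\<And>n. n \<ge> M \<Longrightarrow> \<bar>f n\<bar> \<le> c * real n powr p"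
    unfolding eventually_sequentially by auto
  define s where "s = (\<Sum>k<M. \<bar>f k\<bar> / real k powr p)"
  have s: "s \<ge> 0" unfolding s_def by (intro sum_nonneg) simp
  have "\<bar>f n\<bar> \<le> (c + s) * real n powr p" if n: "n \<ge> 1" for n
  proof (cases "n \<ge> M")
    case True
    then show ?thesis using M[OF True] s by (simp add: distrib_right add_increasing2)
  next
    case False
    then have "\<bar>f n\<bar> / real n powr p \<le> s"
      unfolding s_def by (intro member_le_sum) auto
    then have "\<bar>f n\<bar> / real n powr p \<le> c + s" using c by simp
    then show ?thesis using n by (simp add: divide_le_eq)
  qed
  then show thesis using that[of "c + s"] c s by simp
qed

text \<open>Left unevaluated until \<open>powr_sum_rate\<close>, so that all ranges of
  \<open>\<alpha>\<close> share one argument.\<close>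

definition powr_sum :: "real \<Rightarrow> nat \<Rightarrow> real" where
  "powr_sum \<alpha> N = (\<Sum>n=1..N. real n powr (- \<alpha>))"

lemma powr_sum_Suc: "powr_sum \<alpha> (Suc N) = powr_sum \<alpha> N + real (Suc N) powr (- \<alpha>)"
  by (simp add: powr_sum_def)

lemma powr_sum_ge_one: "N \<ge> 1 \<Longrightarrow> powr_sum \<alpha> N \<ge> 1"
proof (induction N rule: nat_induct_at_least)
  case base
  then show ?case by (simp add: powr_sum_def)
next
  case (Suc N)
  then show ?case by (simp add: powr_sum_Suc add_increasing2)
qed

text \<open>Compare increments: the new term \<open>m\<close> raises the square by twice the old sum
  times \<open>m\<close>, plus \<open>m * m\<close>, and the old sum is at least
  \<open>real N * m\<close> because its terms are no smaller than \<open>m\<close>.\<close>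

lemma sum_powr_le_powr_sum_square:
  assumes "\<alpha> \<ge> 0"
  shows "(\<Sum>n=1..N. real n powr (1 - 2 * \<alpha>)) \<le> (powr_sum \<alpha> N)\<^sup>2"
proof (induction N)
  case 0
  then show ?case by simp
next
  case (Suc N)
  define m where "m = real (Suc N) powr (- \<alpha>)"
  have m: "m \<ge> 0" by (simp add: m_def)
  have "real N * m = (\<Sum>n=1..N. m)" by simp
  also have "\<dots> \<le> powr_sum \<alpha> N"
    unfolding powr_sum_def m_def using assms by (intro sum_mono powr_mono2') auto
  finally have S: "real N * m \<le> powr_sum \<alpha> N" .
  have "real (Suc N) powr (1 - 2 * \<alpha>) = real (Suc N) powr 1 * (m * m)"
    unfolding m_def by (simp only: powr_add[symmetric]) simp
  also have "\<dots> = (real N * m) * m + m * m" by (simp add: algebra_simps)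
  also have "\<dots> \<le> powr_sum \<alpha> N * m + m * m"
    using S m by (intro add_mono mult_right_mono) auto
  also have "\<dots> \<le> 2 * powr_sum \<alpha> N * m + m * m"
    using m order_trans[OF _ S] by simp
  finally have "real (Suc N) powr (1 - 2 * \<alpha>) \<le> 2 * powr_sum \<alpha> N * m + m * m" .
  moreover have "(powr_sum \<alpha> (Suc N))\<^sup>2 = (powr_sum \<alpha> N)\<^sup>2 + (2 * powr_sum \<alpha> N * m + m * m)"
    unfolding powr_sum_Suc m_def[symmetric] by (simp add: power2_eq_square algebra_simps)
  ultimately show ?case using Suc by simp
qed

lemma powr_sum_bounded:
  assumes "\<alpha> > 1"
  shows "powr_sum \<alpha> N \<le> (\<Sum>n. real n powr (- \<alpha>))"
proof -
  have "summable (\<lambda>n. real n powr (- \<alpha>))"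
    using assms by (simp add: summable_real_powr_iff)
  then show ?thesis
    unfolding powr_sum_def by (intro sum_le_suminf) auto
qed

text \<open>The increment \<open>1 / Suc N\<close> is at most the increment of the logarithm, by
  \<open>ln t \<le> t - 1\<close> at \<open>t = N / Suc N\<close>.\<close>

lemma powr_sum_one_le:
  assumes "N \<ge> 1"
  shows "powr_sum 1 N \<le> ln (real N) + 1"
  using assms
proof (induction N rule: nat_induct_at_least)
  case base
  then show ?case by (simp add: powr_sum_def)
next
  case (Suc N)
  have "ln (real N / real (Suc N)) \<le> real N / real (Suc N) - 1"
    using Suc by (intro ln_le_minus_one) simp
  moreover have "real N / real (Suc N) - 1 = - 1 / real (Suc N)" by (simp add: field_simps)
  moreover have "ln (real N / real (Suc N)) = ln (real N) - ln (real (Suc N))"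
    using Suc by (simp add: ln_div)
  ultimately show ?case
    using Suc.IH by (simp add: powr_sum_Suc powr_minus_divide)
qed

text \<open>Each term is at most the increment of an antiderivative, by the mean value theorem. The
  step from 0 is separate because the power is not differentiable there.\<close>

lemma powr_sum_sublinear:
  assumes "0 < \<alpha>" "\<alpha> < 1"
  shows "powr_sum \<alpha> N \<le> real N powr (1 - \<alpha>) / (1 - \<alpha>)"
proof (induction N)
  case 0
  then show ?case by (simp add: powr_sum_def)
next
  case (Suc N)
  have step: "(1 - \<alpha>) * real (Suc N) powr (- \<alpha>) \<le> real (Suc N) powr (1 - \<alpha>) - real N powr (1 - \<alpha>)"
  proof (cases "N = 0")
    case True
    then show ?thesis using assms by simp
  next
    case False
    have "\<exists>z>real N. z < real (Suc N) \<and> real (Suc N) powr (1 - \<alpha>) - real N powr (1 - \<alpha>)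
        = (real (Suc N) - real N) * ((1 - \<alpha>) * z powr (1 - \<alpha> - 1))"
      using False by (intro MVT2 has_real_derivative_powr) auto
    then obtain z where z: "real N < z" "z < real (Suc N)"
      "real (Suc N) powr (1 - \<alpha>) - real N powr (1 - \<alpha>) = (1 - \<alpha>) * z powr (- \<alpha>)" by auto
    have "real (Suc N) powr (- \<alpha>) \<le> z powr (- \<alpha>)"
      using z(1,2) assms by (intro powr_mono2') auto
    then show ?thesis unfolding z(3) using assms by (intro mult_left_mono) auto
  qed
  then have "real (Suc N) powr (- \<alpha>) \<le> (real (Suc N) powr (1 - \<alpha>) - real N powr (1 - \<alpha>)) / (1 - \<alpha>)"
    using assms by (simp add: pos_le_divide_eq mult.commute)
  then show ?case using Suc by (simp add: powr_sum_Suc diff_divide_distrib)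
qed

lemma powr_sum_rate:
  fixes f :: "nat \<Rightarrow> real"
  assumes \<alpha>: "\<alpha> > 0" and C: "C \<ge> 0"
    and f: "\<And>N. N \<ge> 1 \<Longrightarrow> \<bar>f N\<bar> \<le> C * (powr_sum \<alpha> N)\<^sup>2 / (real N)\<^sup>2"
  shows "f \<in> O(\<lambda>N. if \<alpha> > 1 then 1 / (real N)\<^sup>2
                else if \<alpha> = 1 then (ln (real N))\<^sup>2 / (real N)\<^sup>2
                else real N powr (- 2 * \<alpha>))"
proof -
  have pos: "powr_sum \<alpha> N \<ge> 0" for N
    unfolding powr_sum_def by (intro sum_nonneg) simp
  have f': "\<bar>f N\<bar> \<le> C * (b\<^sup>2 / (real N)\<^sup>2)" if "N \<ge> 1" "powr_sum \<alpha> N \<le> b" for N b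
  proof -
    have "C * (powr_sum \<alpha> N)\<^sup>2 / (real N)\<^sup>2 \<le> C * (b\<^sup>2 / (real N)\<^sup>2)"
      unfolding times_divide_eq_right[symmetric]
      using that pos C by (intro mult_left_mono divide_right_mono power_mono) auto
    then show ?thesis using f[OF that(1)] by linarith
  qed
  have bigo: "f \<in> O(r)" if "\<And>N. N \<ge> M \<Longrightarrow> norm (f N) \<le> c * norm (r N)" for r c and M :: nat
    using that by (intro bigoI[of f c]) (auto simp: eventually_sequentially)
  consider "\<alpha> > 1" | "\<alpha> = 1" | "\<alpha> < 1" by linarith
  then show ?thesis
  proof cases
    case 1
    have "norm (f N) \<le> (C * (\<Sum>n. real n powr (- \<alpha>))\<^sup>2) * norm (1 / (real N)\<^sup>2)" if "N \<ge> 1" for N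
      using f'[OF that powr_sum_bounded[OF 1]] by simp
    then have "f \<in> O(\<lambda>N. 1 / (real N)\<^sup>2)"
      by (rule bigo)
    then show ?thesis using 1 by simp
  next
    case 2
    have "norm (f N) \<le> (4 * C) * norm ((ln (real N))\<^sup>2 / (real N)\<^sup>2)" if N: "N \<ge> 3" for N
    proof -
      \<comment> \<open>From \<open>N = 3\<close> on the logarithm is at least 1 and absorbs the
        additive constant; at \<open>N = 1\<close> it vanishes, so no bound could start
        there.\<close>
      have "exp 1 \<le> real N" using N exp_le by linarith
      then have "1 \<le> ln (real N)" using N by (simp add: ln_ge_iff)
      then have "powr_sum \<alpha> N \<le> 2 * ln (real N)"
        using powr_sum_one_le[of N] N 2 by simp
      then show ?thesis using f'[of N "2 * ln (real N)"] N by (simp add: power_mult_distrib mult.assoc mult.left_commute[of C])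
    qed
    then have "f \<in> O(\<lambda>N. (ln (real N))\<^sup>2 / (real N)\<^sup>2)"
      by (rule bigo)
    then show ?thesis using 2 by simp
  next
    case 3
    have "norm (f N) \<le> (C / (1 - \<alpha>)\<^sup>2) * norm (real N powr (- 2 * \<alpha>))" if N: "N \<ge> 1" for N
    proof -
      have "(real N powr (1 - \<alpha>))\<^sup>2 / (real N)\<^sup>2 = (real N powr (1 - \<alpha>)) powr 2 / real N powr 2"
        using N by simp
      also have "\<dots> = real N powr ((1 - \<alpha>) * 2) / real N powr 2"
        by (simp only: powr_powr)
      also have "\<dots> = real N powr ((1 - \<alpha>) * 2 - 2)"
        by (rule powr_diff[symmetric])
      finally have "(real N powr (1 - \<alpha>))\<^sup>2 / (real N)\<^sup>2 = real N powr (- 2 * \<alpha>)"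
        by (simp add: algebra_simps)
      moreover have "C * ((real N powr (1 - \<alpha>) / (1 - \<alpha>))\<^sup>2 / (real N)\<^sup>2)
          = C / (1 - \<alpha>)\<^sup>2 * ((real N powr (1 - \<alpha>))\<^sup>2 / (real N)\<^sup>2)"
        by (simp add: power_divide)
      ultimately have "C * ((real N powr (1 - \<alpha>) / (1 - \<alpha>))\<^sup>2 / (real N)\<^sup>2)
          = C / (1 - \<alpha>)\<^sup>2 * real N powr (- 2 * \<alpha>)" by (simp only:)
      then show ?thesis using f'[OF N powr_sum_sublinear[OF \<alpha> 3]] by simp
    qed
    then have "f \<in> O(\<lambda>N. real N powr (- 2 * \<alpha>))"
      by (rule bigo)
    then show ?thesis using 3 by simp
  qed
qed

text \<open>The right side of the recursion lies between the squares of \<open>\<tau> n + k\<close>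
  and \<open>\<tau> n + c / 2\<close>, so every step adds an amount between two positive
  constants.\<close>

lemma quadratic_recursion_linear_growth:
  fixes \<tau> :: "nat \<Rightarrow> real"
  assumes pos: "\<And>n. \<tau> n > 0" and c: "c > 0"
    and rec: "\<And>n. (\<tau> (Suc n))\<^sup>2 = (\<tau> n)\<^sup>2 + c * \<tau> n"
  obtains k k' where "k > 0" "k' > 0"
    "\<And>n. k * real (Suc n) \<le> \<tau> n" "\<And>n. \<tau> n \<le> k' * real (Suc n)"
proof -
  \<comment> \<open>The bound \<open>\<tau> 0\<close> starts the induction and keeps
    \<open>k \<le> \<tau> n\<close>. With \<open>c / 4\<close>, the terms
    \<open>2 * k * \<tau> n\<close> and \<open>k * k\<close> use at most three quarters of
    \<open>c * \<tau> n\<close>.\<close>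
  define k where "k = min (c / 4) (\<tau> 0)"
  define k' where "k' = max (c / 2) (\<tau> 0)"
  have k: "k > 0" "k \<le> c / 4" "k \<le> \<tau> 0" using pos c by (auto simp: k_def)
  have k': "k' > 0" "k' \<ge> c / 2" "k' \<ge> \<tau> 0" using pos c by (auto simp: k'_def)
  have lower: "k * real (Suc n) \<le> \<tau> n" for n
  proof (induction n)
    case (Suc n)
    have "k \<le> \<tau> n" using order_trans[OF _ Suc, of k] k by (simp add: algebra_simps)
    then have "k * k \<le> c / 4 * \<tau> n" using k by (intro mult_mono) auto
    moreover have "k * \<tau> n \<le> c / 4 * \<tau> n" using k pos[of n] by (intro mult_right_mono) auto
    moreover have "c * \<tau> n \<ge> 0" using c pos[of n] by simp
    ultimately have "(\<tau> n + k)\<^sup>2 \<le> (\<tau> (Suc n))\<^sup>2"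
      unfolding rec by (simp add: power2_eq_square algebra_simps)
    then have "\<tau> n + k \<le> \<tau> (Suc n)"
      by (rule power2_le_imp_le) (rule less_imp_le[OF pos])
    moreover have "k * real (Suc (Suc n)) = k * real (Suc n) + k" by (simp add: algebra_simps)
    ultimately show ?case using Suc by linarith
  qed (use k in simp)
  have upper: "\<tau> n \<le> k' * real (Suc n)" for n
  proof (induction n)
    case (Suc n)
    have "(\<tau> (Suc n))\<^sup>2 \<le> (\<tau> n + c / 2)\<^sup>2"
      unfolding rec by (simp add: power2_eq_square algebra_simps)
    then have "\<tau> (Suc n) \<le> \<tau> n + c / 2"
      by (rule power2_le_imp_le) (use pos[of n] c in simp)
    moreover have "k' * real (Suc (Suc n)) = k' * real (Suc n) + k'" by (simp add: algebra_simps)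
    ultimately show ?case using Suc k'(2) by linarith
  qed (use k' in simp)
  show thesis using that k(1) k'(1) lower upper by blast
qed

text \<open>The error is linear in \<open>a\<close>, which the descent itself must bound. Let
  \<open>M\<close> be the largest \<open>a n\<close> up to \<open>N\<close>. Telescoping up to its
  index gives \<open>M\<^sup>2 / 2 \<le> SB + SA * M\<close>, and Young's inequality with weight 1 /
  4 closes this estimate and bounds the right side by
  \<open>2 * SB + 2 * SA\<^sup>2\<close>.\<close>

lemma perturbed_descent_sum_bound:
  fixes V a A B d :: "nat \<Rightarrow> real"
  assumes step: "\<And>n. d (Suc n) + V (Suc n) \<le> V n + B (Suc n) + A (Suc n) * a (Suc n)"
    and V: "\<And>n. (a n)\<^sup>2 / 2 \<le> V n" and d: "\<And>n. d (Suc n) \<ge> 0"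
    and A: "\<And>n. A (Suc n) \<ge> 0" and B: "\<And>n. B (Suc n) \<ge> 0"
    and a: "\<And>n. a n \<ge> 0"
  shows "(\<Sum>n=1..N. d n) \<le> 2 * (V 0 + (\<Sum>n=1..N. B n)) + 2 * (\<Sum>n=1..N. A n)\<^sup>2"
proof (cases "N = 0")
  case True
  then show ?thesis using V[of 0] by (auto intro: order_trans[of 0 "(a 0)\<^sup>2 / 2"])
next
  case False
  have AB: "A n \<ge> 0" "B n \<ge> 0" "d n \<ge> 0" if "n \<in> {1..N}" for n N
    using that A[of "n - 1"] B[of "n - 1"] d[of "n - 1"] by auto
  have tele: "(\<Sum>n=1..k. d n) + V k \<le> V 0 + (\<Sum>n=1..k. B n) + (\<Sum>n=1..k. A n * a n)" for k
  proof (induction k)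
    case (Suc k)
    then show ?case using step[of k] by simp
  qed simp
  define M where "M = Max (a ` {1..N})"
  define SA where "SA = (\<Sum>n=1..N. A n)"
  define SB where "SB = V 0 + (\<Sum>n=1..N. B n)"
  have M: "a n \<le> M" if "n \<in> {1..N}" for n
    unfolding M_def using that by simp
  have "M \<in> a ` {1..N}" unfolding M_def using False by (intro Max_in) auto
  then obtain k where k: "k \<in> {1..N}" "M = a k" by blast
  have bound: "V 0 + (\<Sum>n=1..j. B n) + (\<Sum>n=1..j. A n * a n) \<le> SB + SA * M" if j: "j \<le> N" for j
  proof -
    have "(\<Sum>n=1..j. A n * a n) \<le> (\<Sum>n=1..N. A n * a n)"
      using j AB(1) a by (intro sum_mono2) auto
    also have "\<dots> \<le> (\<Sum>n=1..N. A n * M)"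
      using AB(1) M by (intro sum_mono mult_left_mono) auto
    also have "\<dots> = SA * M" by (simp add: SA_def sum_distrib_right)
    finally have "(\<Sum>n=1..j. A n * a n) \<le> SA * M" .
    moreover have "(\<Sum>n=1..j. B n) \<le> (\<Sum>n=1..N. B n)"
      using j AB(2) by (intro sum_mono2) auto
    ultimately show ?thesis by (simp add: SB_def)
  qed
  have "0 \<le> (\<Sum>n=1..k. d n)" using AB(3) by (intro sum_nonneg)
  then have "M\<^sup>2 / 2 \<le> SB + SA * M"
    using tele[of k] bound[of k] V[of k] k by simp
  moreover have "0 \<le> (SA - M / 2)\<^sup>2" by simp
  then have "SA * M \<le> SA\<^sup>2 + M\<^sup>2 / 4"
    by (simp add: power2_eq_square algebra_simps)
  ultimately have "SB + SA * M \<le> 2 * SB + 2 * SA\<^sup>2" by linarith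
  moreover have "V N \<ge> 0" using V[of N] zero_le_power2[of "a N"] by linarith
  ultimately show ?thesis
    using tele[of N] bound[of N] unfolding SA_def SB_def by linarith
qed

section \<open>The primal-dual iteration\<close>

lemma saddle_point_finite:
  fixes K :: "'a::real_inner \<Rightarrow>\<^sub>L 'b::real_inner"
  assumes g: "proper_fun g" and h: "proper_fun (convex_conj h)" and saddle: "saddle_point K g h xs ys"
  obtains a b where "g xs = ereal a" "convex_conj h ys = ereal b"
    "\<And>x c. g x = ereal c \<Longrightarrow> K xs \<bullet> ys + a \<le> K x \<bullet> ys + c"
    "\<And>y c. convex_conj h y = ereal c \<Longrightarrow> K xs \<bullet> y - c \<le> K xs \<bullet> ys - b"
proof -
  have le1: "lagrangian K g h xs y \<le> lagrangian K g h xs ys" for y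
    using saddle by (simp add: saddle_point_def)
  have le2: "lagrangian K g h xs ys \<le> lagrangian K g h x ys" for x
    using saddle by (simp add: saddle_point_def)
  obtain x0 a0 where x0: "g x0 = ereal a0" using proper_fun_obtain[OF g] .
  obtain y0 b0 where y0: "convex_conj h y0 = ereal b0" using proper_fun_obtain[OF h] .
  have nm: "g x \<noteq> -\<infinity>" "convex_conj h y \<noteq> -\<infinity>" for x y
    using g h by (auto simp: proper_fun_def)
  \<comment> \<open>This comes first: an infinite \<open>g xs\<close> makes the value at the saddle
    point infinite whatever the conjugate is, whereas the value at \<open>x0\<close> is not plus
    infinity.\<close>
  have "g xs \<noteq> \<infinity>"
    using le2[of x0] x0 nm(2)[of ys] unfolding lagrangian_def
    by (cases "convex_conj h ys") auto
  then obtain a where a: "g xs = ereal a" using nm(1)[of xs] by (cases "g xs") auto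
  have "convex_conj h ys \<noteq> \<infinity>"
    using le1[of y0] y0 a unfolding lagrangian_def by auto
  then obtain b where b: "convex_conj h ys = ereal b" using nm(2)[of ys] by (cases "convex_conj h ys") auto
  show thesis
  proof (rule that[OF a b])
    show "K xs \<bullet> ys + a \<le> K x \<bullet> ys + c" if "g x = ereal c" for x c
      using le2[of x] that a b by (simp add: lagrangian_def)
    show "K xs \<bullet> y - c \<le> K xs \<bullet> ys - b" if "convex_conj h y = ereal c" for y c
      using le1[of y] that a b by (simp add: lagrangian_def)
  qed
qed

text \<open>Jensen's inequality, transferred from \<open>convex_on\<close> by restricting to the set
  \<open>D\<close> where \<open>\<phi>\<close> is finite.\<close>

lemma convex_fun_sum_le:
  fixes \<phi> :: "'a::real_vector \<Rightarrow> ereal" and c :: "'i \<Rightarrow> real"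
  assumes \<phi>: "proper_fun \<phi>" "convex_fun \<phi>"
    and I: "finite I" "I \<noteq> {}" "\<And>i. i \<in> I \<Longrightarrow> w i \<ge> 0" "(\<Sum>i\<in>I. w i) = 1"
    and c: "\<And>i. i \<in> I \<Longrightarrow> \<phi> (u i) = ereal (c i)"
  obtains b where "\<phi> (\<Sum>i\<in>I. w i *\<^sub>R u i) = ereal b" "b \<le> (\<Sum>i\<in>I. w i * c i)"
proof -
  define D where "D = {u. \<bar>\<phi> u\<bar> \<noteq> \<infinity>}"
  have seg: "\<exists>b. \<phi> (s *\<^sub>R x + t *\<^sub>R y) = ereal b
      \<and> b \<le> s * real_of_ereal (\<phi> x) + t * real_of_ereal (\<phi> y)"
    if xy: "x \<in> D" "y \<in> D" and st: "s \<ge> 0" "t \<ge> 0" "s + t = 1" for x y and s t :: real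
  proof -
    obtain a b where ab: "\<phi> x = ereal a" "\<phi> y = ereal b"
      using xy unfolding D_def by (cases "\<phi> x"; cases "\<phi> y") auto
    have s: "s = 1 - t" using st by simp
    have "\<phi> (s *\<^sub>R x + t *\<^sub>R y) \<le> ereal (s * a + t * b)"
    proof (cases "t = 0 \<or> t = 1")
      case True
      then show ?thesis using ab s by auto
    next
      case False
      then show ?thesis unfolding s using convex_fun_ereal[OF \<phi>(2) ab] st by auto
    qed
    moreover have "\<phi> (s *\<^sub>R x + t *\<^sub>R y) \<noteq> -\<infinity>" using \<phi>(1) by (simp add: proper_fun_def)
    ultimately show ?thesis using ab by (cases "\<phi> (s *\<^sub>R x + t *\<^sub>R y)") auto
  qed
  have conv: "convex_on D (\<lambda>u. real_of_ereal (\<phi> u))"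
    unfolding convex_on_def
  proof
    show "convex D"
      unfolding convex_def
    proof (intro ballI allI impI)
      fix x y and s t :: real
      assume "x \<in> D" "y \<in> D" "s \<ge> 0" "t \<ge> 0" "s + t = 1"
      from seg[OF this] show "s *\<^sub>R x + t *\<^sub>R y \<in> D" by (auto simp: D_def)
    qed
    show "\<forall>x\<in>D. \<forall>y\<in>D. \<forall>s\<ge>0. \<forall>t\<ge>0. s + t = 1 \<longrightarrow> real_of_ereal (\<phi> (s *\<^sub>R x + t *\<^sub>R y))
        \<le> s * real_of_ereal (\<phi> x) + t * real_of_ereal (\<phi> y)"
    proof (intro ballI allI impI)
      fix x y and s t :: real
      assume "x \<in> D" "y \<in> D" "s \<ge> 0" "t \<ge> 0" "s + t = 1"
      from seg[OF this] show "real_of_ereal (\<phi> (s *\<^sub>R x + t *\<^sub>R y))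
        \<le> s * real_of_ereal (\<phi> x) + t * real_of_ereal (\<phi> y)" by auto
    qed
  qed
  have uD: "u i \<in> D" if "i \<in> I" for i using c[OF that] by (simp add: D_def)
  have "(\<Sum>i\<in>I. w i *\<^sub>R u i) \<in> D"
    using conv I uD by (intro convex_sum) (auto simp: convex_on_def)
  moreover have "real_of_ereal (\<phi> (\<Sum>i\<in>I. w i *\<^sub>R u i)) \<le> (\<Sum>i\<in>I. w i * real_of_ereal (\<phi> (u i)))"
    using I uD by (intro convex_on_sum[OF _ _ conv]) auto
  ultimately show thesis
    using that[of "real_of_ereal (\<phi> (\<Sum>i\<in>I. w i *\<^sub>R u i))"] c by (simp add: D_def ereal_real)
qed

text \<open>The step-size identity turns \<open>\<tau>\<^sup>2 * (norm K)\<^sup>2\<close> into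
  \<open>\<tau> / \<sigma>\<close>, the weight of the dual distance in the Lyapunov
  function.\<close>

lemma blinfun_young:
  fixes K :: "'a::real_inner \<Rightarrow>\<^sub>L 'b::real_inner"
  assumes "\<tau> > 0" "\<sigma> > 0" "\<tau> * \<sigma> * (norm K)\<^sup>2 = 1" "0 \<le> \<mu>" "\<mu> \<le> \<tau>"
  shows "\<bar>\<mu> * (K d \<bullet> b)\<bar> \<le> (norm d)\<^sup>2 / 2 + \<tau> / \<sigma> * (norm b)\<^sup>2 / 2"
proof -
  have "\<bar>K d \<bullet> b\<bar> \<le> norm (K d) * norm b" by (rule Cauchy_Schwarz_ineq2)
  also have "\<dots> \<le> (norm K * norm d) * norm b"
    by (intro mult_right_mono norm_blinfun) auto
  finally have "\<bar>\<mu> * (K d \<bullet> b)\<bar> \<le> \<mu> * (norm K * norm d * norm b)"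
    using assms(4) by (simp add: abs_mult mult_left_mono)
  also have "\<dots> \<le> \<tau> * (norm K * norm d * norm b)"
    using assms(5) by (intro mult_right_mono) auto
  also have "\<dots> = norm d * (\<tau> * norm K * norm b)" by simp
  also have "\<dots> \<le> (norm d)\<^sup>2 / 2 + (\<tau> * norm K * norm b)\<^sup>2 / 2"
    using sum_squares_bound[of "norm d" "\<tau> * norm K * norm b"] by simp
  also have "(\<tau> * norm K * norm b)\<^sup>2 = \<tau> / \<sigma> * (\<tau> * \<sigma> * (norm K)\<^sup>2) * (norm b)\<^sup>2"
    using assms(2) by (simp add: power_mult_distrib power2_eq_square)
  finally show ?thesis using assms(3) by simp
qed

text \<open>
  The gap dominates \<open>\<gamma> / 2 * (norm (y' - ys))\<^sup>2\<close>, so half of it supplies the \<open>\<gamma> / 4\<close> that the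
  inexact dual step lost from the strong convexity modulus.
\<close>

lemma primal_dual_descent:
  fixes K :: "'a::real_inner \<Rightarrow>\<^sub>L 'b::real_inner"
  assumes pos: "\<tau> > 0" "\<sigma> > 0" "\<tau> * \<sigma> * (norm K)\<^sup>2 = 1" "0 \<le> \<mu>" "\<mu> \<le> \<tau>"
    and extrapolation: "(\<tau> * \<theta>) *\<^sub>R (x - xp) = \<mu> *\<^sub>R (x - xp)"
    and adj: "\<And>u. K u \<bullet> y' = u \<bullet> k"
    and primal: "gx' + (1 / \<tau>) *\<^sub>R (x - \<tau> *\<^sub>R k - x') \<bullet> (xs - x') - E - e * norm (xs - x') \<le> gxs"
    and dual: "fy' + (1 / \<sigma>) *\<^sub>R (y + \<sigma> *\<^sub>R K (x + \<theta> *\<^sub>R (x - xp)) - y') \<bullet> (ys - y')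
        + \<gamma> / 4 * (norm (ys - y'))\<^sup>2 - D \<le> fys"
    and gap: "G = (K x' \<bullet> ys + gx' - fys) - (K xs \<bullet> y' + gxs - fy')"
    and growth: "\<gamma> / 2 * (norm (y' - ys))\<^sup>2 \<le> G"
    and ratio: "\<tau>' / \<sigma>' = \<tau> / \<sigma> + \<gamma> * \<tau>"
  shows "\<tau> / 2 * G + ((norm (x' - xs))\<^sup>2 / 2 + (norm (x' - x))\<^sup>2 / 2
        + \<tau>' / \<sigma>' * (norm (y' - ys))\<^sup>2 / 2 + \<tau> * (K (x' - x) \<bullet> (y' - ys)))
      \<le> ((norm (x - xs))\<^sup>2 / 2 + (norm (x - xp))\<^sup>2 / 2
        + \<tau> / \<sigma> * (norm (y - ys))\<^sup>2 / 2 + \<mu> * (K (x - xp) \<bullet> (y - ys)))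
        + \<tau> * (E + D) + \<tau> * e * norm (x' - xs)"
proof -
  \<comment> \<open>The law of cosines converts the proximal inner products into squared
    distances.\<close>
  have three: "(u - v) \<bullet> (w - v) = ((norm (v - w))\<^sup>2 - (norm (u - w))\<^sup>2 + (norm (v - u))\<^sup>2) / 2"
    for u v w :: "'c::real_inner"
    unfolding power2_norm_eq_inner by (simp add: inner_diff inner_commute field_simps)
  have "(1 / \<tau>) *\<^sub>R (x - \<tau> *\<^sub>R k - x') = (1 / \<tau>) *\<^sub>R (x - x') - k"
    using pos(1) by (simp add: algebra_simps)
  then have "(1 / \<tau>) *\<^sub>R (x - \<tau> *\<^sub>R k - x') \<bullet> (xs - x')
      = (1 / \<tau>) * ((x - x') \<bullet> (xs - x')) + K (x' - xs) \<bullet> y'"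
    by (simp only: adj) (simp add: inner_diff inner_commute)
  with primal have "\<tau> * (gx' + ((1 / \<tau>) * ((x - x') \<bullet> (xs - x')) + K (x' - xs) \<bullet> y') - E - e * norm (xs - x')) \<le> \<tau> * gxs"
    using pos(1) by (intro mult_left_mono) auto
  then have 1: "\<tau> * gx' + ((norm (x' - xs))\<^sup>2 - (norm (x - xs))\<^sup>2 + (norm (x' - x))\<^sup>2) / 2
      + \<tau> * (K (x' - xs) \<bullet> y') - \<tau> * E - \<tau> * e * norm (x' - xs) \<le> \<tau> * gxs"
    unfolding three using pos(1) by (simp add: algebra_simps norm_minus_commute[of xs])
  let ?b = "K (x - xp) \<bullet> (y' - ys)"
  have "(1 / \<sigma>) *\<^sub>R (y + \<sigma> *\<^sub>R K (x + \<theta> *\<^sub>R (x - xp)) - y')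
      = (1 / \<sigma>) *\<^sub>R (y - y') + K x + \<theta> *\<^sub>R K (x - xp)"
    unfolding blinfun.add_right blinfun.scaleR_right
    using pos(2) by (simp add: scaleR_add_right scaleR_diff_right)
  then have "(1 / \<sigma>) *\<^sub>R (y + \<sigma> *\<^sub>R K (x + \<theta> *\<^sub>R (x - xp)) - y') \<bullet> (ys - y')
      = (1 / \<sigma>) * ((y - y') \<bullet> (ys - y')) - K x \<bullet> (y' - ys) - \<theta> * ?b"
    by (simp only:) (simp add: inner_add_left inner_diff_right right_diff_distrib)
  with dual have "\<tau> * (fy' + ((1 / \<sigma>) * ((y - y') \<bullet> (ys - y')) - K x \<bullet> (y' - ys) - \<theta> * ?b)
        + \<gamma> / 4 * (norm (y' - ys))\<^sup>2 - D) \<le> \<tau> * fys"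
    using pos(1) by (intro mult_left_mono) (auto simp: norm_minus_commute)
  moreover have "\<tau> * \<theta> * ?b = \<mu> * ?b"
    using arg_cong[OF extrapolation, of "\<lambda>u. K u \<bullet> (y' - ys)"] by (simp add: blinfun.scaleR_right)
  ultimately have 2: "\<tau> * fy' + \<tau> / \<sigma> * ((norm (y' - ys))\<^sup>2 - (norm (y - ys))\<^sup>2 + (norm (y' - y))\<^sup>2) / 2
      - \<tau> * (K x \<bullet> (y' - ys)) - \<mu> * ?b + \<gamma> * \<tau> * (norm (y' - ys))\<^sup>2 / 4 - \<tau> * D \<le> \<tau> * fys"
    unfolding three using pos(1) by (simp add: algebra_simps)
  \<comment> \<open>The extrapolation couples to \<open>y'\<close>, but the Lyapunov function to
    \<open>y\<close>. The difference is paid by the squared dual step gained in inequality 2 and by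
    the squared primal step kept from the previous iteration.\<close>
  have "?b = K (x - xp) \<bullet> (y - ys) + K (x - xp) \<bullet> (y' - y)"
    by (simp add: inner_diff_right)
  then have 3: "\<mu> * ?b \<le> \<mu> * (K (x - xp) \<bullet> (y - ys)) + (norm (x - xp))\<^sup>2 / 2 + \<tau> / \<sigma> * (norm (y' - y))\<^sup>2 / 2"
    using blinfun_young[OF pos, of "x - xp" "y' - y"] by (simp add: distrib_left abs_le_iff)
  have "\<tau> * (\<gamma> / 2 * (norm (y' - ys))\<^sup>2) \<le> \<tau> * G"
    using growth pos(1) by (intro mult_left_mono) auto
  then have 4: "\<tau> / 2 * G + \<gamma> * \<tau> * (norm (y' - ys))\<^sup>2 / 4 \<le> \<tau> * G" by (simp add: algebra_simps)
  have 5: "\<tau> * G = \<tau> * (K x' \<bullet> ys) - \<tau> * (K xs \<bullet> y') + \<tau> * gx' - \<tau> * gxs + \<tau> * fy' - \<tau> * fys"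
    unfolding gap by (simp add: algebra_simps)
  have 6: "\<tau> * (K x' \<bullet> ys) - \<tau> * (K xs \<bullet> y') - \<tau> * (K (x' - xs) \<bullet> y') + \<tau> * (K x \<bullet> (y' - ys))
      = - (\<tau> * (K (x' - x) \<bullet> (y' - ys)))"
    by (simp add: blinfun.diff_right inner_diff algebra_simps)
  have 7: "\<tau>' / \<sigma>' * (norm (y' - ys))\<^sup>2 / 2 = \<tau> / \<sigma> * (norm (y' - ys))\<^sup>2 / 2 + \<gamma> * \<tau> * (norm (y' - ys))\<^sup>2 / 2"
    unfolding ratio by (simp add: field_simps)
  have 8: "\<tau> / \<sigma> * ((norm (y' - ys))\<^sup>2 - (norm (y - ys))\<^sup>2 + (norm (y' - y))\<^sup>2) / 2
      = \<tau> / \<sigma> * (norm (y' - ys))\<^sup>2 / 2 - \<tau> / \<sigma> * (norm (y - ys))\<^sup>2 / 2 + \<tau> / \<sigma> * (norm (y' - y))\<^sup>2 / 2"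
    by (simp only: right_diff_distrib distrib_left add_divide_distrib diff_divide_distrib)
  have 9: "\<tau> * (E + D) = \<tau> * E + \<tau> * D" by (rule distrib_left)
  \<comment> \<open>What remains is linear once products are atoms: \<open>A1\<close>,
    \<open>A2\<close> and \<open>B1\<close>, \<open>B2\<close> stand for primal and weighted dual
    squared distances, \<open>D1\<close>, \<open>D2\<close> and \<open>Q\<close> for squared steps,
    \<open>F1\<close>, \<open>F2\<close>, \<open>G1\<close>, \<open>G2\<close> for scaled function
    values, \<open>k1\<close> to \<open>k5\<close> and \<open>m\<close>, \<open>m'\<close> for
    couplings.\<close>
  have "hG + (A2 / 2 + D2 / 2 + (B2 / 2 + gB / 2) + k2) \<le> (A1 / 2 + D1 / 2 + B1 / 2 + m') + (tE + tD) + te"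
    if "G1 + (A2 - A1 + D2) / 2 + k1 - tE - te \<le> G2"
      "F1 + (B2 / 2 - B1 / 2 + Q / 2) - k3 - m + gB / 4 - tD \<le> F2"
      "m \<le> m' + D1 / 2 + Q / 2" "hG + gB / 4 \<le> tG"
      "tG = k4 - k5 + G1 - G2 + F1 - F2" "k4 - k5 - k1 + k3 = - k2"
    for hG tG gB A1 A2 B1 B2 D1 D2 F1 F2 G1 G2 Q k1 k2 k3 k4 k5 m m' tE tD te :: real
  proof -
    have "tG \<le> (A1 - A2 - D2) / 2 + (B1 / 2 - B2 / 2 - Q / 2) + m - gB / 4 - k2 + tE + te + tD"
      using that(1,2,5,6) by argo
    with that(3,4) show ?thesis by argo
  qed
  from this[OF 1 2[unfolded 8] 3 4 5 6] show ?thesis unfolding 7 9 .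
qed

text \<open>The flag \<open>b\<close> stands for type 2. As \<open>\<tau> (n - 1)\<close> is of
  order \<open>n\<close>, the additive errors are of order \<open>n powr (1 - 2 * \<alpha>)\<close>,
  and without \<open>b\<close> the linear coefficients are of order
  \<open>n powr (- \<alpha>)\<close>.\<close>

lemma inexactness_budget:
  fixes \<tau> \<epsilon> \<delta> :: "nat \<Rightarrow> real"
  assumes \<tau>: "\<And>n. \<tau> n > 0" "\<And>n. \<tau> n \<le> k * real (Suc n)"
    and nonneg: "\<And>n. n \<ge> 1 \<Longrightarrow> \<epsilon> n \<ge> 0" "\<And>n. n \<ge> 1 \<Longrightarrow> \<delta> n \<ge> 0"
    and \<alpha>: "\<alpha> > 0"
    and \<delta>: "\<delta> \<in> O(\<lambda>n. real n powr (- 2 * \<alpha>))"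
    and \<epsilon>: "\<not> b \<Longrightarrow> \<epsilon> \<in> O(\<lambda>n. real n powr (- (1 + 2 * \<alpha>)))"
      "b \<Longrightarrow> \<epsilon> \<in> O(\<lambda>n. real n powr (- 2 * \<alpha>))"
  obtains C where "C \<ge> 0"
    "\<And>N. (\<Sum>n=1..N. \<tau> (n - 1) * (2 * \<epsilon> n + 7 / 2 * \<delta> n)) \<le> C * (powr_sum \<alpha> N)\<^sup>2"
    "\<And>N. (\<Sum>n=1..N. \<tau> (n - 1) * (if b then 0 else sqrt (2 * \<epsilon> n / \<tau> (n - 1))))\<^sup>2 \<le> C * (powr_sum \<alpha> N)\<^sup>2"
proof -
  have \<tau>1: "0 < \<tau> (n - 1)" "\<tau> (n - 1) \<le> k * real n" if "n \<ge> 1" for n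
    using \<tau>(1)[of "n - 1"] \<tau>(2)[of "n - 1"] that by auto
  have k: "k > 0" using \<tau>(1)[of 0] \<tau>(2)[of 0] by simp
  obtain Cd where Cd: "Cd \<ge> 0" "\<And>n. n \<ge> 1 \<Longrightarrow> \<bar>\<delta> n\<bar> \<le> Cd * real n powr (- 2 * \<alpha>)"
    by (rule bigo_powr_bound[OF \<delta>]) blast
  \<comment> \<open>The additive errors use the slower rate in every case; the faster rate of types
    1 and 3 implies it with the same constant.\<close>
  obtain Ce where Ce: "Ce \<ge> 0" "\<And>n. n \<ge> 1 \<Longrightarrow> \<bar>\<epsilon> n\<bar> \<le> Ce * real n powr (- 2 * \<alpha>)"
    "\<And>n. \<not> b \<Longrightarrow> n \<ge> 1 \<Longrightarrow> \<bar>\<epsilon> n\<bar> \<le> Ce * real n powr (- (1 + 2 * \<alpha>))"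
  proof (cases b)
    case True
    show thesis by (rule bigo_powr_bound[OF \<epsilon>(2)[OF True]]) (rule that; use True in simp)
  next
    case False
    show thesis
    proof (rule bigo_powr_bound[OF \<epsilon>(1)[OF False]])
      fix C assume C: "C \<ge> 0" "\<And>n. n \<ge> 1 \<Longrightarrow> \<bar>\<epsilon> n\<bar> \<le> C * real n powr (- (1 + 2 * \<alpha>))"
      have "\<bar>\<epsilon> n\<bar> \<le> C * real n powr (- 2 * \<alpha>)" if n: "n \<ge> 1" for n
      proof -
        have "real n powr (- (1 + 2 * \<alpha>)) \<le> real n powr (- 2 * \<alpha>)"
          using n by (intro powr_mono) auto
        then show ?thesis using C(2)[OF n] C(1) by (meson mult_left_mono order_trans)
      qed
      then show thesis using that C by blast
    qed
  qed
  define C1 where "C1 = k * (2 * Ce + 7 / 2 * Cd)"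
  define C2 where "C2 = sqrt (2 * Ce * k)"
  have B: "(\<Sum>n=1..N. \<tau> (n - 1) * (2 * \<epsilon> n + 7 / 2 * \<delta> n)) \<le> C1 * (powr_sum \<alpha> N)\<^sup>2" for N
  proof -
    have "\<tau> (n - 1) * (2 * \<epsilon> n + 7 / 2 * \<delta> n) \<le> C1 * real n powr (1 - 2 * \<alpha>)" if "n \<in> {1..N}" for n
    proof -
      have n: "n \<ge> 1" using that by simp
      have "2 * \<epsilon> n + 7 / 2 * \<delta> n \<le> (2 * Ce + 7 / 2 * Cd) * real n powr (- 2 * \<alpha>)"
        using Cd(2)[OF n] Ce(2)[OF n] by (simp add: distrib_right)
      then have "\<tau> (n - 1) * (2 * \<epsilon> n + 7 / 2 * \<delta> n) \<le> (k * real n) * ((2 * Ce + 7 / 2 * Cd) * real n powr (- 2 * \<alpha>))"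
        using \<tau>1[OF n] nonneg[OF n] k by (intro mult_mono) auto
      also have "\<dots> = C1 * (real n powr 1 * real n powr (- 2 * \<alpha>))" by (simp add: C1_def)
      also have "real n powr 1 * real n powr (- 2 * \<alpha>) = real n powr (1 - 2 * \<alpha>)"
        by (simp only: powr_add[symmetric]) simp
      finally show ?thesis .
    qed
    then have "(\<Sum>n=1..N. \<tau> (n - 1) * (2 * \<epsilon> n + 7 / 2 * \<delta> n)) \<le> (\<Sum>n=1..N. C1 * real n powr (1 - 2 * \<alpha>))"
      by (intro sum_mono)
    also have "\<dots> = C1 * (\<Sum>n=1..N. real n powr (1 - 2 * \<alpha>))" by (rule sum_distrib_left[symmetric])
    also have "\<dots> \<le> C1 * (powr_sum \<alpha> N)\<^sup>2"
      using \<alpha> k Ce(1) Cd(1) by (intro mult_left_mono sum_powr_le_powr_sum_square) (auto simp: C1_def)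
    finally show ?thesis .
  qed
  let ?A = "\<lambda>n. \<tau> (n - 1) * (if b then 0 else sqrt (2 * \<epsilon> n / \<tau> (n - 1)))"
  have A: "(\<Sum>n=1..N. ?A n)\<^sup>2 \<le> C2\<^sup>2 * (powr_sum \<alpha> N)\<^sup>2" for N
  proof -
    have A_nonneg: "0 \<le> ?A n" if "n \<in> {1..N}" for n
      using that nonneg(1)[of n] \<tau>1(1)[of n] by simp
    have "?A n \<le> C2 * real n powr (- \<alpha>)" if "n \<in> {1..N}" for n
    proof (cases b)
      case True
      then show ?thesis using Ce(1) k by (simp add: C2_def)
    next
      case False
      have n: "n \<ge> 1" using that by simp
      have "(sqrt (2 * \<epsilon> n / \<tau> (n - 1)))\<^sup>2 = 2 * \<epsilon> n / \<tau> (n - 1)"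
        using \<tau>1(1)[OF n] nonneg(1)[OF n] by simp
      \<comment> \<open>Multiplying by \<open>\<tau> (n - 1)\<close> outside the root leaves one
        factor of it under the root, which cancels the extra 1 / n in the rate of
        \<open>\<epsilon>\<close>.\<close>
      then have "(?A n)\<^sup>2 = 2 * \<epsilon> n * \<tau> (n - 1)"
        using \<tau>1(1)[OF n] False by (simp only: power_mult_distrib if_False) (simp add: power2_eq_square)
      also have "\<dots> \<le> 2 * (Ce * real n powr (- (1 + 2 * \<alpha>))) * (k * real n)"
        using \<tau>1[OF n] nonneg(1)[OF n] Ce(1) Ce(3)[OF False n] by (intro mult_mono) auto
      also have "\<dots> = 2 * Ce * k * (real n powr (- (1 + 2 * \<alpha>)) * real n powr 1)" by simp
      also have "real n powr (- (1 + 2 * \<alpha>)) * real n powr 1 = real n powr (- \<alpha>) * real n powr (- \<alpha>)"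
        by (simp only: powr_add[symmetric]) simp
      also have "2 * Ce * k * (real n powr (- \<alpha>) * real n powr (- \<alpha>)) = (C2 * real n powr (- \<alpha>))\<^sup>2"
        using Ce(1) k by (simp add: C2_def power_mult_distrib power2_eq_square)
      finally show ?thesis
        by (rule power2_le_imp_le) (use Ce(1) k in \<open>simp add: C2_def\<close>)
    qed
    then have "(\<Sum>n=1..N. ?A n) \<le> (\<Sum>n=1..N. C2 * real n powr (- \<alpha>))"
      by (intro sum_mono)
    also have "\<dots> = C2 * powr_sum \<alpha> N" unfolding powr_sum_def by (rule sum_distrib_left[symmetric])
    finally have "(\<Sum>n=1..N. ?A n)\<^sup>2 \<le> (C2 * powr_sum \<alpha> N)\<^sup>2"
      using A_nonneg by (intro power_mono sum_nonneg) auto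
    then show ?thesis by (simp add: power_mult_distrib)
  qed
  have max: "s * (powr_sum \<alpha> N)\<^sup>2 \<le> max C1 (C2\<^sup>2) * (powr_sum \<alpha> N)\<^sup>2" if "s = C1 \<or> s = C2\<^sup>2" for s N
    using that by (intro mult_right_mono) auto
  show thesis
    by (rule that[of "max C1 (C2\<^sup>2)"])
      (use order_trans[OF A max] order_trans[OF B max] in \<open>auto simp: le_max_iff_disj\<close>)
qed

text \<open>For a fixed saddle point the gap is convex in the pair of iterates, so Jensen's
  inequality bounds it at the averages; the saddle inequalities make it nonnegative. The witness
  \<open>R\<close> also provides the finiteness that \<open>ereal_bigo\<close> demands.\<close>

lemma ergodic_gap_bound:
  fixes K :: "'a::{real_inner, complete_space} \<Rightarrow>\<^sub>L 'b::{real_inner, complete_space}"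
    and gv fv :: "nat \<Rightarrow> real"
  assumes g: "proper_fun g" "convex_fun g"
    and f: "proper_fun (convex_conj h)" "convex_fun (convex_conj h)"
    and saddle: "saddle_point K g h xs ys" "g xs = ereal gs" "convex_conj h ys = ereal fs"
    and \<tau>: "\<And>n. \<tau> n > 0" and N: "N \<ge> 1"
    and gv: "\<And>n. n \<ge> 1 \<Longrightarrow> g (x n) = ereal (gv n)"
    and fv: "\<And>n. n \<ge> 1 \<Longrightarrow> convex_conj h (y n) = ereal (fv n)"
  obtains R where "R \<ge> 0"
    "lagrangian K g h (ergodic_avg \<tau> x N) ys - lagrangian K g h xs (ergodic_avg \<tau> y N) = ereal R"
    "R * (\<Sum>n=1..N. \<tau> (n - 1))
      \<le> (\<Sum>n=1..N. \<tau> (n - 1) * ((K (x n) \<bullet> ys + gv n - fs) - (K xs \<bullet> y n + gs - fv n)))"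
proof -
  define S where "S = (\<Sum>n=1..N. \<tau> (n - 1))"
  define w where "w n = \<tau> (n - 1) / S" for n
  have S: "S > 0" unfolding S_def using N \<tau> by (intro sum_pos) auto
  have T: "avg_weight \<tau> N = S / \<tau> 0"
    by (simp add: avg_weight_def S_def sum_divide_distrib)
  have avg: "ergodic_avg \<tau> z N = (\<Sum>n=1..N. w n *\<^sub>R z n)" for z :: "nat \<Rightarrow> 'c::real_vector"
    unfolding ergodic_avg_def T w_def scaleR_sum_right using \<tau>[of 0] by simp
  have w: "w n \<ge> 0" for n using \<tau>[of "n - 1"] S by (simp add: w_def)
  have w1: "(\<Sum>n=1..N. w n) = 1"
    using S unfolding w_def sum_divide_distrib[symmetric] S_def[symmetric] by simp
  obtain gX where gX: "g (\<Sum>n=1..N. w n *\<^sub>R x n) = ereal gX" "gX \<le> (\<Sum>n=1..N. w n * gv n)"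
    by (rule convex_fun_sum_le[OF g, of "{1..N}" w x gv]) (use N w w1 gv in auto)
  obtain fY where fY: "convex_conj h (\<Sum>n=1..N. w n *\<^sub>R y n) = ereal fY" "fY \<le> (\<Sum>n=1..N. w n * fv n)"
    by (rule convex_fun_sum_le[OF f, of "{1..N}" w y fv]) (use N w w1 fv in auto)
  define X where "X = (\<Sum>n=1..N. w n *\<^sub>R x n)"
  define Y where "Y = (\<Sum>n=1..N. w n *\<^sub>R y n)"
  define R where "R = (K X \<bullet> ys + gX - fs) - (K xs \<bullet> Y + gs - fY)"
  have KX: "K X \<bullet> ys = (\<Sum>n=1..N. w n * (K (x n) \<bullet> ys))"
    by (simp add: X_def blinfun.sum_right blinfun.scaleR_right inner_sum_left)
  have KY: "K xs \<bullet> Y = (\<Sum>n=1..N. w n * (K xs \<bullet> y n))"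
    by (simp add: Y_def inner_sum_right)
  have eq: "lagrangian K g h X ys - lagrangian K g h xs Y = ereal R"
    using gX(1)[folded X_def] fY(1)[folded Y_def] saddle(2,3) by (simp add: lagrangian_def R_def)
  have "lagrangian K g h xs Y \<le> lagrangian K g h X ys"
    using saddle(1) unfolding saddle_point_def by (meson order_trans)
  then have "R \<ge> 0"
    using gX(1)[folded X_def] fY(1)[folded Y_def] saddle(2,3) by (simp add: lagrangian_def R_def)
  moreover have "R \<le> (\<Sum>n=1..N. w n * ((K (x n) \<bullet> ys + gv n - fs) - (K xs \<bullet> y n + gs - fv n)))"
  proof -
    have "(\<Sum>n=1..N. w n * ((K (x n) \<bullet> ys + gv n - fs) - (K xs \<bullet> y n + gs - fv n)))
        = (\<Sum>n=1..N. w n * (K (x n) \<bullet> ys)) + (\<Sum>n=1..N. w n * gv n) - (\<Sum>n=1..N. w n) * fs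
          - ((\<Sum>n=1..N. w n * (K xs \<bullet> y n)) + (\<Sum>n=1..N. w n) * gs - (\<Sum>n=1..N. w n * fv n))"
      by (simp only: distrib_left right_diff_distrib sum.distrib sum_subtractf sum_distrib_right)
    then show ?thesis using gX(2) fY(2) unfolding w1 R_def KX KY by linarith
  qed
  then have "R * S \<le> (\<Sum>n=1..N. w n * ((K (x n) \<bullet> ys + gv n - fs) - (K xs \<bullet> y n + gs - fv n))) * S"
    using S by (intro mult_right_mono) auto
  then have "R * S \<le> (\<Sum>n=1..N. \<tau> (n - 1) * ((K (x n) \<bullet> ys + gv n - fs) - (K xs \<bullet> y n + gs - fv n)))"
    using S by (simp add: sum_distrib_right w_def)
  ultimately show thesis
    using that[of R] eq unfolding S_def avg X_def Y_def by blast
qed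

theorem corollary3p14:
  fixes K :: "'x::{real_inner, complete_space} \<Rightarrow>\<^sub>L 'y::{real_inner, complete_space}"
    and g :: "'x \<Rightarrow> ereal" and h :: "'y \<Rightarrow> ereal"
    and \<gamma> \<alpha> :: real and i :: nat
    and \<tau> \<sigma> \<theta> \<epsilon> \<delta> :: "nat \<Rightarrow> real"
    and x :: "nat \<Rightarrow> 'x" and y :: "nat \<Rightarrow> 'y"
    and xs :: 'x and ys :: 'y
  assumes g: "proper_fun g" "convex_fun g" "lsc_fun g"
    and h: "proper_fun h" "convex_fun h" "lsc_fun h"
    and \<gamma>: "\<gamma> > 0" and strong: "strongly_convex \<gamma> (convex_conj h)"
    and init: "\<tau> 0 > 0" "\<sigma> 0 > 0" "\<tau> 0 * \<sigma> 0 * (norm K)\<^sup>2 = 1"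
    and \<theta>: "\<And>n. \<theta> (Suc n) = 1 / sqrt (1 + \<gamma> * \<sigma> n)"
    and \<sigma>: "\<And>n. \<sigma> (Suc n) = \<theta> (Suc n) * \<sigma> n"
    and \<tau>: "\<And>n. \<tau> (Suc n) = \<tau> n / \<theta> (Suc n)"
    and i: "i \<in> {1, 2, 3}"
    and nonneg: "\<And>n. n \<ge> 1 \<Longrightarrow> \<epsilon> n \<ge> 0" "\<And>n. n \<ge> 1 \<Longrightarrow> \<delta> n \<ge> 0"
    \<comment> \<open>For \<open>n = 0\<close> truncated subtraction gives \<open>x (n - 1) = x 0\<close>, i.e. the convention that
        the iterate with index \<open>-1\<close> equals \<open>x 0\<close>.\<close>
    and y_step: "\<And>n. approx_prox2 (\<delta> (Suc n)) (\<sigma> n) (convex_conj h)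
            (y n + \<sigma> n *\<^sub>R blinfun_apply K (x n + \<theta> n *\<^sub>R (x n - x (n - 1)))) (y (Suc n))"
    and x_step: "\<And>n. approx_prox i (\<epsilon> (Suc n)) (\<tau> n) g
            (x n - \<tau> n *\<^sub>R adjoint (blinfun_apply K) (y (Suc n))) (x (Suc n))"
    and \<alpha>: "\<alpha> > 0"
    and \<delta>_rate: "\<delta> \<in> O(\<lambda>n. real n powr (- 2 * \<alpha>))"
    and \<epsilon>_rate13: "i \<in> {1, 3} \<Longrightarrow> \<epsilon> \<in> O(\<lambda>n. real n powr (- (1 + 2 * \<alpha>)))"
    and \<epsilon>_rate2: "i = 2 \<Longrightarrow> \<epsilon> \<in> O(\<lambda>n. real n powr (- 2 * \<alpha>))"
    and saddle: "saddle_point K g h xs ys"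
  shows "ereal_bigo
           (\<lambda>N. lagrangian K g h (ergodic_avg \<tau> x N) ys - lagrangian K g h xs (ergodic_avg \<tau> y N))
           (\<lambda>N. if \<alpha> > 1 then 1 / (real N)\<^sup>2
                else if \<alpha> = 1 then (ln (real N))\<^sup>2 / (real N)\<^sup>2
                else real N powr (- 2 * \<alpha>))"
proof -
  let ?F = "convex_conj h"
  have F: "proper_fun ?F" "convex_fun ?F" "lsc_fun ?F"
    using convex_conj_proper[OF h] convex_conj_convex[OF h(1)] convex_conj_lsc[OF h(1)] by auto
  obtain u0 h0 where u0: "h u0 = ereal h0" using proper_fun_obtain[OF h(1)] .
  \<comment> \<open>A finite value of \<open>h\<close> gives an affine minorant of its conjugate, as
    the existence of proximal points of the conjugate requires.\<close>
  have minorant: "ereal (u0 \<bullet> p + (- h0)) \<le> ?F p" for p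
    using convex_conj_ge[of h, OF u0] by simp
  obtain gs fs where gs: "g xs = ereal gs" and fs: "?F ys = ereal fs"
    and saddle_x: "\<And>x c. g x = ereal c \<Longrightarrow> K xs \<bullet> ys + gs \<le> K x \<bullet> ys + c"
    and saddle_y: "\<And>y c. ?F y = ereal c \<Longrightarrow> K xs \<bullet> y - c \<le> K xs \<bullet> ys - fs"
    by (rule saddle_point_finite[OF g(1) F(1) saddle]) blast

  \<comment> \<open>Step sizes: invariants and growth\<close>
  have pos: "\<tau> n > 0" "\<sigma> n > 0" for n
  proof (induction n)
    case (Suc n)
    have "1 + \<gamma> * \<sigma> n > 0" using \<gamma> Suc(2) by (simp add: add_pos_pos)
    then have "\<theta> (Suc n) > 0" by (simp add: \<theta>)
    then show "\<tau> (Suc n) > 0" "\<sigma> (Suc n) > 0" using Suc by (simp_all add: \<tau> \<sigma>)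
  qed (use init in auto)
  have inv: "(1 / \<theta> (Suc n))\<^sup>2 = 1 + \<gamma> * \<sigma> n" "0 < \<theta> (Suc n)" "\<theta> (Suc n) \<le> 1" for n
  proof -
    have "1 + \<gamma> * \<sigma> n > 1" using \<gamma> pos(2)[of n] by simp
    then show "(1 / \<theta> (Suc n))\<^sup>2 = 1 + \<gamma> * \<sigma> n" "0 < \<theta> (Suc n)" "\<theta> (Suc n) \<le> 1"
      by (simp_all add: \<theta>)
  qed
  have prod: "\<tau> n * \<sigma> n * (norm K)\<^sup>2 = 1" for n
  proof (induction n)
    case (Suc n)
    then show ?case using inv(2)[of n] by (simp add: \<tau> \<sigma>)
  qed (use init in simp)
  have ratio: "\<tau> (Suc n) / \<sigma> (Suc n) = \<tau> n / \<sigma> n + \<gamma> * \<tau> n" for n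
  proof -
    have "\<tau> (Suc n) / \<sigma> (Suc n) = (1 / \<theta> (Suc n))\<^sup>2 * (\<tau> n / \<sigma> n)"
      by (simp add: \<tau> \<sigma> power2_eq_square)
    then show ?thesis unfolding inv using pos(2)[of n] by (simp add: field_simps)
  qed
  have K: "(norm K)\<^sup>2 > 0" using init(3) by (cases "norm K = 0") auto
  \<comment> \<open>As \<open>\<tau> n * \<sigma> n\<close> is constant, the factor
    \<open>1 + \<gamma> * \<sigma> n\<close> adds to the square a term only linear in
    \<open>\<tau> n\<close>.\<close>
  have rec: "(\<tau> (Suc n))\<^sup>2 = (\<tau> n)\<^sup>2 + \<gamma> / (norm K)\<^sup>2 * \<tau> n" for n
  proof -
    have ts: "\<tau> n * \<sigma> n = 1 / (norm K)\<^sup>2" using prod[of n] K by (simp add: eq_divide_eq)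
    have "(\<tau> (Suc n))\<^sup>2 = (1 / \<theta> (Suc n))\<^sup>2 * (\<tau> n)\<^sup>2"
      by (simp add: \<tau> power_divide)
    also have "\<dots> = (\<tau> n)\<^sup>2 + \<gamma> * (\<tau> n * \<sigma> n) * \<tau> n"
      unfolding inv by (simp add: power2_eq_square algebra_simps)
    finally show ?thesis unfolding ts by simp
  qed
  obtain k k' where k: "k > 0" "k' > 0" "\<And>n. k * real (Suc n) \<le> \<tau> n" "\<And>n. \<tau> n \<le> k' * real (Suc n)"
    by (rule quadratic_recursion_linear_growth[of \<tau> "\<gamma> / (norm K)\<^sup>2"])
      (use pos(1) rec \<gamma> K in auto)
  \<comment> \<open>Needed because the coupling in \<open>V n\<close> carries the older weight
    \<open>\<tau> (n - 1)\<close>, which \<open>blinfun_young\<close> compares with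
    \<open>\<tau> n\<close>.\<close>
  have mono: "\<tau> (n - 1) \<le> \<tau> n" for n
  proof (cases n)
    case (Suc m)
    have "\<tau> m * \<theta> (Suc m) \<le> \<tau> m" using inv(3)[of m] pos(1)[of m] by (simp add: mult_left_le)
    then show ?thesis using Suc inv(2)[of m] by (simp add: \<tau> pos_le_divide_eq)
  qed simp
  \<comment> \<open>Stated for the vectors, not the scalars: \<open>\<theta> 0\<close> is arbitrary,
    but at \<open>n = 0\<close> the difference vanishes by truncated subtraction.\<close>
  have extrapolation: "(\<tau> n * \<theta> n) *\<^sub>R (x n - x (n - 1)) = \<tau> (n - 1) *\<^sub>R (x n - x (n - 1))" for n
  proof (cases n)
    case (Suc m)
    then show ?thesis using inv(2)[of m] by (simp add: \<tau>)
  qed simp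

  \<comment> \<open>Subgradient inequalities along the iteration\<close>
  define e where "e n = (if i = 2 then 0 else sqrt (2 * \<epsilon> n / \<tau> (n - 1)))" for n
  define gv where "gv n = real_of_ereal (g (x n))" for n
  define fv where "fv n = real_of_ereal (?F (y n))" for n
  have primal: "g (x (Suc n)) = ereal (gv (Suc n)) \<and> gv (Suc n)
      + (1 / \<tau> n) *\<^sub>R (x n - \<tau> n *\<^sub>R adjoint (blinfun_apply K) (y (Suc n)) - x (Suc n)) \<bullet> (xs - x (Suc n))
      - 2 * \<epsilon> (Suc n) - e (Suc n) * norm (xs - x (Suc n)) \<le> gs" for n
    by (rule approx_prox_subgradient[OF g(1,2) pos(1) _ x_step[of n]])
      (use nonneg(1)[of "Suc n"] gs in \<open>auto simp: gv_def e_def\<close>)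
  have dual: "?F (y (Suc n)) = ereal (fv (Suc n)) \<and> fv (Suc n)
      + (1 / \<sigma> n) *\<^sub>R (y n + \<sigma> n *\<^sub>R K (x n + \<theta> n *\<^sub>R (x n - x (n - 1))) - y (Suc n)) \<bullet> (ys - y (Suc n))
      + \<gamma> / 4 * (norm (ys - y (Suc n)))\<^sup>2 - 7 / 2 * \<delta> (Suc n) \<le> fs" for n
  proof -
    note sub = y_step[of n, unfolded approx_prox2_def]
    obtain a where a: "?F (y (Suc n)) = ereal a"
      by (rule eps_subdiff_finite[OF F(1) sub])
    then have "?F (y (Suc n)) = ereal (fv (Suc n))" by (simp add: fv_def)
    then show ?thesis
      using strongly_convex_eps_subgradient[OF F minorant \<gamma> strong sub _ fs] by blast
  qed
  have gv: "g (x n) = ereal (gv n)" and fv: "?F (y n) = ereal (fv n)" if "n \<ge> 1" for n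
    using primal[of "n - 1"] dual[of "n - 1"] that by auto

  \<comment> \<open>The gap of the iterates\<close>
  define G where "G n = (K (x n) \<bullet> ys + gv n - fs) - (K xs \<bullet> y n + gs - fv n)" for n
  have "K xs \<in> subdiff ?F ys"
    unfolding subdiff_def mem_Collect_eq
  proof
    fix v
    show "?F ys + ereal (K xs \<bullet> (v - ys)) \<le> ?F v"
    proof (cases "?F v")
      case (real c)
      then show ?thesis using saddle_y[OF real] fs by (simp add: inner_diff_right)
    qed (use F(1) in \<open>auto simp: proper_fun_def\<close>)
  qed
  then have "?F ys + ereal (K xs \<bullet> (v - ys)) + ereal (\<gamma> / 2 * (norm (v - ys))\<^sup>2) \<le> ?F v" for v
    using strong unfolding strongly_convex_def dom_subdiff_def by blast
  then have quad: "fs + K xs \<bullet> (y n - ys) + \<gamma> / 2 * (norm (y n - ys))\<^sup>2 \<le> fv n" if "n \<ge> 1" for n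
    using fv[OF that] fs by (metis ereal_less_eq(3) plus_ereal.simps(1))
  \<comment> \<open>\<open>G n\<close> is a primal part, nonnegative by \<open>saddle_x\<close>,
    plus a dual part, bounded below by \<open>quad\<close>.\<close>
  have growth: "\<gamma> / 2 * (norm (y n - ys))\<^sup>2 \<le> G n" if "n \<ge> 1" for n
    using quad[OF that] saddle_x[OF gv[OF that]] by (simp add: G_def inner_diff_right)
  have G_nonneg: "G n \<ge> 0" if "n \<ge> 1" for n
  proof -
    have "0 \<le> \<gamma> / 2 * (norm (y n - ys))\<^sup>2" using \<gamma> by simp
    then show ?thesis using growth[OF that] by linarith
  qed

  \<comment> \<open>The Lyapunov function and its descent\<close>
  define V where "V n = (norm (x n - xs))\<^sup>2 / 2 + (norm (x n - x (n - 1)))\<^sup>2 / 2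
      + \<tau> n / \<sigma> n * (norm (y n - ys))\<^sup>2 / 2 + \<tau> (n - 1) * (K (x n - x (n - 1)) \<bullet> (y n - ys))" for n
  \<comment> \<open>Young's inequality bounds the coupling by exactly the step term and the dual
    distance term, so only the primal distance survives.\<close>
  have V: "(norm (x n - xs))\<^sup>2 / 2 \<le> V n" for n
    using blinfun_young[OF pos[of n] prod[of n] less_imp_le[OF pos(1)[of "n - 1"]] mono[of n],
        of "x n - x (n - 1)" "y n - ys"]
    unfolding V_def by (simp add: abs_le_iff)
  have descent: "\<tau> n / 2 * G (Suc n) + V (Suc n)
      \<le> V n + \<tau> n * (2 * \<epsilon> (Suc n) + 7 / 2 * \<delta> (Suc n)) + \<tau> n * e (Suc n) * norm (x (Suc n) - xs)" for n
    using primal_dual_descent[OF pos[of n] prod[of n] less_imp_le[OF pos(1)[of "n - 1"]] mono[of n]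
        extrapolation[of n] adjoint_blinfun conjunct2[OF primal[of n]] conjunct2[OF dual[of n]]
        G_def[of "Suc n"] growth[of "Suc n"] ratio[of n]]
    by (simp add: V_def)
  have total: "(\<Sum>n=1..N. \<tau> (n - 1) / 2 * G n)
      \<le> 2 * (V 0 + (\<Sum>n=1..N. \<tau> (n - 1) * (2 * \<epsilon> n + 7 / 2 * \<delta> n))) + 2 * (\<Sum>n=1..N. \<tau> (n - 1) * e n)\<^sup>2" for N
  proof (rule perturbed_descent_sum_bound[where a = "\<lambda>n. norm (x n - xs)"])
    fix n
    show "\<tau> (Suc n - 1) / 2 * G (Suc n) + V (Suc n)
        \<le> V n + \<tau> (Suc n - 1) * (2 * \<epsilon> (Suc n) + 7 / 2 * \<delta> (Suc n))
          + \<tau> (Suc n - 1) * e (Suc n) * norm (x (Suc n) - xs)"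
      using descent[of n] by simp
    show "0 \<le> \<tau> (Suc n - 1) / 2 * G (Suc n)" "0 \<le> \<tau> (Suc n - 1) * e (Suc n)"
      "0 \<le> \<tau> (Suc n - 1) * (2 * \<epsilon> (Suc n) + 7 / 2 * \<delta> (Suc n))"
      using pos(1)[of n] G_nonneg[of "Suc n"] nonneg[of "Suc n"] by (simp_all add: e_def)
  qed (use V in auto)

  \<comment> \<open>Summation and rates\<close>
  obtain C where C: "C \<ge> 0"
    "\<And>N. (\<Sum>n=1..N. \<tau> (n - 1) * (2 * \<epsilon> n + 7 / 2 * \<delta> n)) \<le> C * (powr_sum \<alpha> N)\<^sup>2"
    "\<And>N. (\<Sum>n=1..N. \<tau> (n - 1) * e n)\<^sup>2 \<le> C * (powr_sum \<alpha> N)\<^sup>2"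
    unfolding e_def
    by (rule inexactness_budget[where b = "i = 2", OF pos(1) k(4) nonneg \<alpha> \<delta>_rate])
      (use i \<epsilon>_rate13 \<epsilon>_rate2 in auto)
  have V0: "V 0 \<ge> 0" using V[of 0] by (rule order_trans[rotated]) simp
  \<comment> \<open>Of \<open>4 * C\<close>, one half comes from the additive errors and one from
    the squared linear ones. The factor \<open>4 / k\<close> undoes the halved gap in
    \<open>total\<close> and the lower bound \<open>k * (real N)\<^sup>2 / 2\<close> on the total
    weight.\<close>
  define M where "M = 4 / k * (2 * V 0 + 4 * C)"
  have M: "M \<ge> 0" using k(1) V0 C(1) by (simp add: M_def)
  let ?gap = "\<lambda>N. lagrangian K g h (ergodic_avg \<tau> x N) ys - lagrangian K g h xs (ergodic_avg \<tau> y N)"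
  have main: "\<exists>R. ?gap N = ereal R \<and> \<bar>R\<bar> \<le> M * (powr_sum \<alpha> N)\<^sup>2 / (real N)\<^sup>2" if N: "N \<ge> 1" for N
  proof -
    obtain R where R: "R \<ge> 0" "?gap N = ereal R"
      "R * (\<Sum>n=1..N. \<tau> (n - 1)) \<le> (\<Sum>n=1..N. \<tau> (n - 1) * G n)"
      unfolding G_def
      by (rule ergodic_gap_bound[OF g(1,2) F(1,2) saddle gs fs pos(1) N gv fv]) blast
    have weights: "k * (real j)\<^sup>2 / 2 \<le> (\<Sum>n=1..j. \<tau> (n - 1))" for j
    proof (induction j)
      case (Suc j)
      have "k * (real (Suc j))\<^sup>2 / 2 \<le> k * (real j)\<^sup>2 / 2 + k * real (Suc j)"
        using k(1) by (simp add: power2_eq_square algebra_simps)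
      also have "\<dots> \<le> (\<Sum>n=1..j. \<tau> (n - 1)) + \<tau> j"
        using Suc k(3)[of j] by (rule add_mono)
      finally show ?case by simp
    qed simp
    \<comment> \<open>This lets the initial value \<open>V 0\<close> be absorbed into a multiple of
      the squared power sum.\<close>
    have "(powr_sum \<alpha> N)\<^sup>2 \<ge> 1" using powr_sum_ge_one[OF N] by (simp add: one_le_power)
    then have "V 0 \<le> V 0 * (powr_sum \<alpha> N)\<^sup>2" using V0 by (simp add: mult_le_cancel_left1)
    have "R * (k * (real N)\<^sup>2 / 2) \<le> R * (\<Sum>n=1..N. \<tau> (n - 1))"
      using R(1) weights by (intro mult_left_mono)
    also have "\<dots> \<le> 2 * (\<Sum>n=1..N. \<tau> (n - 1) / 2 * G n)"
      using R(3) by (simp add: sum_distrib_left)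
    also have "\<dots> \<le> 2 * ((2 * V 0 + 4 * C) * (powr_sum \<alpha> N)\<^sup>2)"
      using total[of N] C(2)[of N] C(3)[of N] \<open>V 0 \<le> V 0 * (powr_sum \<alpha> N)\<^sup>2\<close> by (simp add: algebra_simps)
    finally have "R \<le> M * (powr_sum \<alpha> N)\<^sup>2 / (real N)\<^sup>2"
      using N k(1) by (simp add: M_def field_simps)
    with R show ?thesis by auto
  qed
  show ?thesis
    unfolding ereal_bigo_def
  proof
    show "\<forall>N\<ge>1. \<bar>?gap N\<bar> \<noteq> \<infinity>" using main by fastforce
    show "(\<lambda>N. real_of_ereal (?gap N)) \<in> O(\<lambda>N. if \<alpha> > 1 then 1 / (real N)\<^sup>2
                else if \<alpha> = 1 then (ln (real N))\<^sup>2 / (real N)\<^sup>2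
                else real N powr (- 2 * \<alpha>))"
    proof (rule powr_sum_rate[OF \<alpha> M])
      fix N :: nat assume "N \<ge> 1"
      from main[OF this] show "\<bar>real_of_ereal (?gap N)\<bar> \<le> M * (powr_sum \<alpha> N)\<^sup>2 / (real N)\<^sup>2"
        by auto
    qed
  qed
qed

end
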